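(* Let $L$ be either of the two lattices $A_3(C_{28,3}(D_{14}))$ or $A_5(C_{28,5}(D'_{14}))$ defined below. Then for a positive integer $k$, $L$ contains a $k$-frame if and only if $k\ge 3$. Here: for $m\times m$ negacirculant integer matrices $A_1,A_2$, put $N(A_1,A_2)=\begin{pmatrix} A_1 & A_2\\ -A_2^T & A_1^T\end{pmatrix}$. $D_{14}=N(A_1,A_2)$ with $7\times 7$ negacirculant $A_1,A_2$ having first rows $(0,2,1,0,0,1,2)$ and $(-1,-2,1,-2,2,1,0)$; $D'_{14}=N(A_1',A_2')$ with $7\times7$ negacirculant $A_1',A_2'$ having first rows $(0,0,2,-1,-1,2,0)$ and $(-2,-1,-2,0,-1,-1,-2)$. $C_{28,3}(D_{14})$ is the $\mathbb{Z}_3$-code of length $28$ generated by the rows of $(I_{14}\ \ D_{14}+I_{14})$ read modulo $3$, and $C_{28,5}(D'_{14})$ is the $\mathbb{Z}_5$-code of length $28$ generated by the rows of $(I_{14}\ \ D'_{14}+2I_{14})$ read modulo $5$.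
   Context: An $m\times m$ matrix is negacirculant if its first row is $(r_0,\dots,r_{m-1})$ and each subsequent row is obtained from the previous one by shifting cyclically one place to the right and negating the entry that wraps around; i.e. its $(i,j)$ entry is $r_{j-i}$ if $j\ge i$ and $-r_{m+j-i}$ if $j<i$. For a $\mathbb{Z}_k$-code $C$ of length $n$ (a $\mathbb{Z}_k$-submodule of $\mathbb{Z}_k^n$), Construction A gives $A_k(C)=\frac{1}{\sqrt{k}}\{x\in\mathbb{Z}^n : (x_1 \bmod k,\dots,x_n\bmod k)\in C\}$; these codes are self-dual, so the lattices are unimodular. (These two lattices are odd unimodular lattices of dimension $28$ with minimum norm $3$, namely the lattices $\mathbf{R}_{28,32}(\emptyset)$ and $\mathbf{R}_{28,15}(\emptyset)$ of the Bacher–Venkov classification.) A $k$-frame of a lattice $L$ of dimension $n$ is a set of $n$ vectors $f_1,\dots,f_n\in L$ with $(f_i,f_j)=k\delta_{i,j}$, where $(\cdot,\cdot)$ is the standard inner product. *)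

theory Defs
  imports Complex_Main "Jordan_Normal_Form.Matrix"
begin

text \<open>The negacirculant matrix whose first row is the list \<open>r\<close>; its size is the length of \<open>r\<close>.\<close>

definition negacirculant :: "int list \<Rightarrow> int mat" where
  "negacirculant r = mat (length r) (length r)
     (\<lambda>(i, j). if i \<le> j then r ! (j - i) else - (r ! (length r + j - i)))"

definition N_mat :: "int mat \<Rightarrow> int mat \<Rightarrow> int mat" where
  "N_mat A1 A2 = four_block_mat A1 A2 (- transpose_mat A2) (transpose_mat A1)"

definition D14 :: "int mat" where
  "D14 = N_mat (negacirculant [0, 2, 1, 0, 0, 1, 2])
               (negacirculant [-1, -2, 1, -2, 2, 1, 0])"

definition D14' :: "int mat" where
  "D14' = N_mat (negacirculant [0, 0, 2, -1, -1, 2, 0])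
                (negacirculant [-2, -1, -2, 0, -1, -1, -2])"

text \<open>An element of \<open>\<int>\<^sub>k\<close> is represented by its residue in \<open>{0..<k}\<close>, so that a \<open>\<int>\<^sub>k\<close>-code is a set
  of integer vectors with entries in that range, closed under the operations modulo \<open>k\<close>.\<close>

definition vec_mod :: "nat \<Rightarrow> int vec \<Rightarrow> int vec" where
  "vec_mod k x = map_vec (\<lambda>a. a mod int k) x"

text \<open>The \<open>\<int>\<^sub>k\<close>-code generated by the rows of \<open>G\<close>: the product below is the integral linear
  combination of these rows with coefficient vector \<open>c\<close>.\<close>

definition code_generated :: "nat \<Rightarrow> int mat \<Rightarrow> int vec set" where
  "code_generated k G =
     {vec_mod k (transpose_mat G *\<^sub>v c) | c. c \<in> carrier_vec (dim_row G)}"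

text \<open>The matrix \<open>(A  B)\<close>, for \<open>A\<close> and \<open>B\<close> with the same number of rows.\<close>

definition hconcat_mat :: "'a mat \<Rightarrow> 'a mat \<Rightarrow> 'a mat" where
  "hconcat_mat A B = mat (dim_row A) (dim_col A + dim_col B)
     (\<lambda>(i, j). if j < dim_col A then A $$ (i, j) else B $$ (i, j - dim_col A))"

definition C_28_3 :: "int mat \<Rightarrow> int vec set" where
  "C_28_3 D = code_generated 3 (hconcat_mat (1\<^sub>m 14) (D + 1\<^sub>m 14))"

definition C_28_5 :: "int mat \<Rightarrow> int vec set" where
  "C_28_5 D = code_generated 5 (hconcat_mat (1\<^sub>m 14) (D + 2 \<cdot>\<^sub>m 1\<^sub>m 14))"

definition construction_A :: "nat \<Rightarrow> nat \<Rightarrow> int vec set \<Rightarrow> real vec set" where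
  "construction_A n k C =
     {(1 / sqrt (real k)) \<cdot>\<^sub>v map_vec real_of_int x | x. x \<in> carrier_vec n \<and> vec_mod k x \<in> C}"

definition is_frame :: "nat \<Rightarrow> nat \<Rightarrow> real vec set \<Rightarrow> (nat \<Rightarrow> real vec) \<Rightarrow> bool" where
  "is_frame n k L f \<longleftrightarrow>
     (\<forall>i<n. f i \<in> L) \<and>
     (\<forall>i<n. \<forall>j<n. scalar_prod (f i) (f j) = (if i = j then real k else 0))"

text \<open>For \<open>k > 0\<close> the vectors of a frame are automatically distinct.\<close>

definition contains_frame :: "nat \<Rightarrow> nat \<Rightarrow> real vec set \<Rightarrow> bool" where
  "contains_frame n k L \<longleftrightarrow> (\<exists>f. is_frame n k L f)"

end

(* Both lattices are isometric to A_3 of a ternary self-dual code C_B in which Z^28 is read as Z[i]^14 and C_B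
   is the image modulo 3 of x |-> (1 + i) x + conj(x) B, for a skew-symmetric 14 x 14 matrix B over Z[i] with
   B B* = 13 I. The maps x |-> alpha x + beta conj(x) B are similarities of norm |alpha|^2 + 13 |beta|^2, and
   those with alpha = (1 + i) conj(beta) (mod 3) have image in C_B; dividing by sqrt 3 they give k-frames for
   all values k of a quaternary form of determinant 169. A prime p is a value of this form as soon as
   p = x^2 + y^2 + z^2 + w^2 with 13 | x + 5 y + 3 z - 2 w. A sum of four squares admits such an arrangement
   up to order and signs unless it is very special modulo 13 (a scalar multiple of a unit of the Hurwitz order,
   possibly times 1 + i), and then it is moved to a better one by a rotation with denominator 13 or 3. Since
   28 is divisible by 4, quaternion multiplication turns a k-frame into a km-frame for every m, so the odd
   primes and k = 4 suffice. That L has no vectors of norm 1 and 2 is a minimum weight computation in C_B. *)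
theory Submission
  imports Defs "HOL-Computational_Algebra.Primes" "HOL-Library.Multiset"
begin

section \<open>Sums of four squares\<close>

text \<open>Write J for x |-> conj(x) B. Skew-symmetry gives conj(x) B conj(x)^T = 0, so alpha x is
  orthogonal to beta J x; this is why alpha + beta J is a similarity. Moreover J^2 = -13 and J i =
  -i J, so these maps span the quaternion algebra (-1, -13) over the rationals, and 13 = |2 + 3 i|^2
  identifies it with Hamilton's quaternions. Hence the link with four squares: the form is
  integrally equivalent to x^2 + y^2 + z^2 + w^2 on the sublattice of index 13 cut out by x + 5 y +
  3 z - 2 w, through the unimodular substitution in \<open>frame_form_of_adapted\<close>. The vector
  (1, 5, 3, -2) has norm 39 and is isotropic modulo 13.

  The obstacle is that Lagrange's theorem gives no control over residues modulo 13: the exceptional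
  residue vectors are missed by every signed permutation of (1, 5, 3, -2), so there the
  representation itself has to be changed. The form does not take the value 4, since no sum of four
  squares equal to 4 lies in the sublattice; this is why a 4-frame is supplied separately.\<close>

definition four_sq :: "int \<Rightarrow> bool" where
  "four_sq n \<longleftrightarrow> (\<exists>a b c d. n = a\<^sup>2 + b\<^sup>2 + c\<^sup>2 + d\<^sup>2)"

lemma four_sqI: "n = a\<^sup>2 + b\<^sup>2 + c\<^sup>2 + d\<^sup>2 \<Longrightarrow> four_sq n"
  unfolding four_sq_def by blast

lemma euler_four_square:
  fixes a b c d x y z w :: int
  shows "(a\<^sup>2 + b\<^sup>2 + c\<^sup>2 + d\<^sup>2) * (x\<^sup>2 + y\<^sup>2 + z\<^sup>2 + w\<^sup>2) =
    (a*x + b*y + c*z + d*w)\<^sup>2 + (a*y - b*x + c*w - d*z)\<^sup>2 +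
    (a*z - c*x + d*y - b*w)\<^sup>2 + (a*w - d*x + b*z - c*y)\<^sup>2"
  by Groebner_Basis.algebra

lemma four_sq_mult: "four_sq m \<Longrightarrow> four_sq n \<Longrightarrow> four_sq (m * n)"
  unfolding four_sq_def using euler_four_square by metis

lemma half_residue:
  fixes x m :: int
  assumes "m > 0"
  obtains y where "m dvd x - y" "2 * \<bar>y\<bar> \<le> m"
proof (cases "2 * (x mod m) \<le> m")
  case True
  show ?thesis
    by (rule that[of "x mod m"]) (use True assms in \<open>auto simp: minus_mod_eq_mult_div\<close>)
next
  case False
  have "x - (x mod m - m) = m * (x div m + 1)"
    by (simp add: algebra_simps flip: minus_mod_eq_mult_div)
  then have "m dvd x - (x mod m - m)" by (metis dvd_triv_left)
  moreover have "2 * \<bar>x mod m - m\<bar> \<le> m"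
    using False pos_mod_bound[OF assms, of x] by auto
  ultimately show ?thesis using that by blast
qed

lemma square_bound:
  fixes y m :: int
  assumes "2 * \<bar>y\<bar> \<le> m" shows "4 * y\<^sup>2 \<le> m\<^sup>2"
proof -
  have "(2 * \<bar>y\<bar>)\<^sup>2 \<le> m\<^sup>2" using assms by (intro power_mono) auto
  then show ?thesis by (simp add: power_mult_distrib)
qed

text \<open>The boundary case |y| = m/2 of the descent: there x^2 is m^2/4 modulo m^2, so four such
  squares add up to a multiple of m^2.\<close>

lemma square_residue_extreme:
  fixes x y m :: int
  assumes "m dvd x - y" "4 * y\<^sup>2 = m\<^sup>2"
  obtains t where "4 * x\<^sup>2 = m\<^sup>2 + 4 * m\<^sup>2 * t"
proof -
  obtain s where s: "x = y + m * s" using assms(1) by (metis add.commute diff_add_cancel dvdE)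
  have "(2 * y)\<^sup>2 = m\<^sup>2" using assms(2) by (simp add: power_mult_distrib)
  then consider "m = 2 * y" | "m = - 2 * y" by (metis power2_eq_iff mult_minus_left minus_equation_iff)
  then show ?thesis
  proof cases
    case 1
    have "4 * x\<^sup>2 = m\<^sup>2 + 4 * m\<^sup>2 * (s + s\<^sup>2)" unfolding s 1 by Groebner_Basis.algebra
    then show ?thesis by (rule that)
  next
    case 2
    have "4 * x\<^sup>2 = m\<^sup>2 + 4 * m\<^sup>2 * (s\<^sup>2 - s)" unfolding s 2 by Groebner_Basis.algebra
    then show ?thesis by (rule that)
  qed
qed

text \<open>Pigeonhole: x^2 and -1 - y^2 each take (p + 1)/2 distinct values modulo p for x and y
  between 0 and (p - 1)/2. The bounds keep the resulting multiple of p below p^2, so that the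
  descent can start.\<close>

lemma prime_dvd_one_plus_two_squares:
  fixes p :: int
  assumes "prime p" "odd p"
  obtains x y where "p dvd x\<^sup>2 + y\<^sup>2 + 1" "0 \<le> x" "2 * x < p" "0 \<le> y" "2 * y < p"
proof -
  define h where "h = (p - 1) div 2"
  have p: "p = 2 * h + 1" using assms(2) by (auto simp: h_def elim!: oddE)
  have p2: "p > 1" using assms(1) by (simp add: prime_gt_1_int)
  let ?S = "{0..h}"
  define f where "f x = x\<^sup>2 mod p" for x :: int
  define g where "g y = (- 1 - y\<^sup>2) mod p" for y :: int
  have key: "x = y" if "x \<in> ?S" "y \<in> ?S" "p dvd x\<^sup>2 - y\<^sup>2" for x y
  proof -
    have "p dvd (x - y) * (x + y)" using that(3) by (simp add: power2_eq_square algebra_simps)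
    then consider "p dvd x - y" | "p dvd x + y" using prime_dvd_multD[OF assms(1)] by blast
    then show ?thesis
    proof cases
      case 1
      have "\<bar>x - y\<bar> < p" using that p by auto
      then show ?thesis using 1 zdvd_not_zless[of "\<bar>x - y\<bar>" p] by (cases "x = y") auto
    next
      case 2
      have "x + y = 0"
      proof (rule ccontr)
        assume "x + y \<noteq> 0"
        then have "0 < x + y" using that by auto
        moreover have "x + y < p" using that p by auto
        ultimately show False using 2 zdvd_not_zless by blast
      qed
      then show ?thesis using that by auto
    qed
  qed
  have "inj_on f ?S"
    by (rule inj_onI, rule key) (auto simp: f_def mod_eq_dvd_iff)
  then have cf: "card (f ` ?S) = nat (h + 1)" by (simp add: card_image)
  have "inj_on g ?S"
  proof (rule inj_onI)
    fix x y assume xy: "x \<in> ?S" "y \<in> ?S" "g x = g y"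
    then have "p dvd (- 1 - x\<^sup>2) - (- 1 - y\<^sup>2)" by (simp add: g_def mod_eq_dvd_iff)
    then have "p dvd y\<^sup>2 - x\<^sup>2" by simp
    then show "x = y" using key[OF xy(2,1)] by simp
  qed
  then have cg: "card (g ` ?S) = nat (h + 1)" by (simp add: card_image)
  have "f ` ?S \<inter> g ` ?S \<noteq> {}"
  proof
    assume "f ` ?S \<inter> g ` ?S = {}"
    then have "card (f ` ?S \<union> g ` ?S) = nat (h + 1) + nat (h + 1)"
      by (subst card_Un_disjoint) (auto simp: cf cg)
    moreover have "f ` ?S \<union> g ` ?S \<subseteq> {0..<p}" using p2 by (auto simp: f_def g_def)
    then have "card (f ` ?S \<union> g ` ?S) \<le> card {0..<p}" by (intro card_mono) auto
    ultimately show False using p p2 by simp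
  qed
  then obtain x y where xy: "x \<in> ?S" "y \<in> ?S" "f x = g y" by blast
  then have "p dvd x\<^sup>2 - (- 1 - y\<^sup>2)" by (simp add: f_def g_def mod_eq_dvd_iff)
  then have "p dvd x\<^sup>2 + y\<^sup>2 + 1" by (simp add: algebra_simps)
  then show ?thesis using that xy p by auto
qed

text \<open>Replacing a, b, c, d by least absolute residues modulo m gives a sum m r with r at most
  m. In Euler's product of the two sums every term is divisible by m, and dividing by m^2 leaves r
  p. The extremes r = 0 and r = m would make m^2 divide m p.\<close>

lemma four_sq_descent:
  fixes p m :: int
  assumes "prime p" "1 < m" "m < p" "four_sq (m * p)"
  obtains r where "0 < r" "r < m" "four_sq (r * p)"
proof -
  obtain a b c d where abcd: "m * p = a\<^sup>2 + b\<^sup>2 + c\<^sup>2 + d\<^sup>2" using assms(4) unfolding four_sq_def by blast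
  have m0: "m > 0" using assms by simp
  obtain x where x: "m dvd a - x" "2 * \<bar>x\<bar> \<le> m" using half_residue[OF m0] by blast
  obtain y where y: "m dvd b - y" "2 * \<bar>y\<bar> \<le> m" using half_residue[OF m0] by blast
  obtain z where z: "m dvd c - z" "2 * \<bar>z\<bar> \<le> m" using half_residue[OF m0] by blast
  obtain w where w: "m dvd d - w" "2 * \<bar>w\<bar> \<le> m" using half_residue[OF m0] by blast
  have not: "\<not> m\<^sup>2 dvd m * p"
  proof
    assume "m\<^sup>2 dvd m * p"
    then have "m dvd p" using m0 by (simp add: power2_eq_square)
    then show False using assms(1,2,3)
      by (metis m0 order_less_irrefl prime_int_iff order.strict_implies_order)
  qed
  obtain a' where a': "a = x + m * a'" using x(1) by (metis add.commute diff_add_cancel dvdE)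
  obtain b' where b': "b = y + m * b'" using y(1) by (metis add.commute diff_add_cancel dvdE)
  obtain c' where c': "c = z + m * c'" using z(1) by (metis add.commute diff_add_cancel dvdE)
  obtain d' where d': "d = w + m * d'" using w(1) by (metis add.commute diff_add_cancel dvdE)
  let ?s = "x\<^sup>2 + y\<^sup>2 + z\<^sup>2 + w\<^sup>2"
  have "m * p = ?s + m * (2 * x * a' + 2 * y * b' + 2 * z * c' + 2 * w * d' + m * (a'\<^sup>2 + b'\<^sup>2 + c'\<^sup>2 + d'\<^sup>2))"
    unfolding abcd a' b' c' d' by Groebner_Basis.algebra
  then have "?s = m * (p - (2 * x * a' + 2 * y * b' + 2 * z * c' + 2 * w * d' + m * (a'\<^sup>2 + b'\<^sup>2 + c'\<^sup>2 + d'\<^sup>2)))"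
    by (simp add: algebra_simps)
  then obtain r where r: "?s = m * r" by blast
  note bounds = square_bound[OF x(2)] square_bound[OF y(2)] square_bound[OF z(2)] square_bound[OF w(2)]
  have "m * r \<ge> 0" using r by (metis add_nonneg_nonneg zero_le_power2)
  then have "r \<ge> 0" using m0 by (simp add: zero_le_mult_iff)
  have "r \<noteq> 0"
  proof
    assume "r = 0"
    then have "x = 0 \<and> y = 0 \<and> z = 0 \<and> w = 0" using r
      by (simp add: add_nonneg_eq_0_iff)
    then have "m * p = m\<^sup>2 * (a'\<^sup>2 + b'\<^sup>2 + c'\<^sup>2 + d'\<^sup>2)" unfolding abcd a' b' c' d' by Groebner_Basis.algebra
    then show False using not by simp
  qed
  moreover have "m * r \<le> m * m" using bounds r by (simp add: power2_eq_square)
  then have "r \<le> m" using m0 by simp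
  moreover have "r \<noteq> m"
  proof
    assume "r = m"
    then have "4 * x\<^sup>2 = m\<^sup>2" "4 * y\<^sup>2 = m\<^sup>2" "4 * z\<^sup>2 = m\<^sup>2" "4 * w\<^sup>2 = m\<^sup>2"
      using bounds r by (simp_all add: power2_eq_square)
    then obtain s t u v where "4 * a\<^sup>2 = m\<^sup>2 + 4 * m\<^sup>2 * s" "4 * b\<^sup>2 = m\<^sup>2 + 4 * m\<^sup>2 * t"
        "4 * c\<^sup>2 = m\<^sup>2 + 4 * m\<^sup>2 * u" "4 * d\<^sup>2 = m\<^sup>2 + 4 * m\<^sup>2 * v"
      using square_residue_extreme[OF x(1)] square_residue_extreme[OF y(1)]
        square_residue_extreme[OF z(1)] square_residue_extreme[OF w(1)] by metis
    then have "4 * (m * p) = 4 * (m\<^sup>2 * (1 + s + t + u + v))"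
      unfolding abcd by (simp add: algebra_simps)
    then have "m * p = m\<^sup>2 * (1 + s + t + u + v)" by simp
    then show False using not by simp
  qed
  ultimately have r': "0 < r" "r < m" using \<open>r \<ge> 0\<close> by auto
  define A B C D where "A = p - (a' * x + b' * y + c' * z + d' * w) - m * (a'\<^sup>2 + b'\<^sup>2 + c'\<^sup>2 + d'\<^sup>2)"
    and "B = a' * y - b' * x + c' * w - d' * z"
    and "C = a' * z - c' * x + d' * y - b' * w" and "D = a' * w - d' * x + b' * z - c' * y"
  have "a*x + b*y + c*z + d*w = m * p - m * (a * a' + b * b' + c * c' + d * d')"
    unfolding abcd a' b' c' d' by Groebner_Basis.algebra
  then have e1: "a*x + b*y + c*z + d*w = m * A"
    unfolding A_def a' b' c' d' by Groebner_Basis.algebra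
  have e: "a*y - b*x + c*w - d*z = m * B" "a*z - c*x + d*y - b*w = m * C" "a*w - d*x + b*z - c*y = m * D"
    unfolding B_def C_def D_def a' b' c' d' by Groebner_Basis.algebra+
  have "(m * p) * (m * r) = (m * A)\<^sup>2 + (m * B)\<^sup>2 + (m * C)\<^sup>2 + (m * D)\<^sup>2"
    unfolding r[symmetric] abcd euler_four_square e1 e ..
  then have "m\<^sup>2 * (r * p) = m\<^sup>2 * (A\<^sup>2 + B\<^sup>2 + C\<^sup>2 + D\<^sup>2)"
    by (simp add: power2_eq_square algebra_simps)
  then have "r * p = A\<^sup>2 + B\<^sup>2 + C\<^sup>2 + D\<^sup>2" using m0 by simp
  then show ?thesis using that r' four_sqI by blast
qed

lemma four_sq_prime_of_multiple:
  fixes p :: int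
  assumes "prime p"
  shows "0 < m \<Longrightarrow> m < p \<Longrightarrow> four_sq (m * p) \<Longrightarrow> four_sq p"
proof (induction "nat m" arbitrary: m rule: less_induct)
  case less
  show ?case
  proof (cases "m = 1")
    case True
    then show ?thesis using less.prems by simp
  next
    case False
    then obtain r where "0 < r" "r < m" "four_sq (r * p)"
      using four_sq_descent[OF assms, of m] less.prems by (metis int_one_le_iff_zero_less less_le)
    then show ?thesis using less.hyps[of r] less.prems by auto
  qed
qed

lemma four_sq_prime:
  fixes p :: int
  assumes "prime p"
  shows "four_sq p"
proof (cases "odd p")
  case False
  then have "p = 2" using assms by (metis primes_dvd_imp_eq two_is_prime_nat prime_int_numeral_eq)
  then show ?thesis by (intro four_sqI[of _ 1 1 0 0]) simp
next
  case True
  obtain x y where xy: "p dvd x\<^sup>2 + y\<^sup>2 + 1" "0 \<le> x" "2 * x < p" "0 \<le> y" "2 * y < p"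
    using prime_dvd_one_plus_two_squares[OF assms True] by blast
  obtain m where m: "x\<^sup>2 + y\<^sup>2 + 1 = p * m" using xy(1) by blast
  have p: "p > 1" using assms prime_gt_1_int by blast
  have "4 * x\<^sup>2 \<le> (p - 1)\<^sup>2" "4 * y\<^sup>2 \<le> (p - 1)\<^sup>2"
    by (intro square_bound; use xy in auto)+
  then have "4 * (p * m) \<le> 2 * (p - 1)\<^sup>2 + 4" using m by simp
  also have "\<dots> < 4 * (p * p)" using p by (simp add: power2_eq_square algebra_simps) (smt (verit) mult_less_cancel_left2 mult_less_cancel_right)
  finally have "m < p" using p by simp
  moreover have "p * m > 0" using m by (smt (verit) zero_le_power2)
  then have "m > 0" using p by (simp add: zero_less_mult_iff)
  moreover have "four_sq (m * p)" by (rule four_sqI[of _ x y 1 0]) (use m in \<open>simp add: mult.commute\<close>)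
  ultimately show ?thesis using four_sq_prime_of_multiple[OF assms] by blast
qed

theorem lagrange_four_squares: "four_sq (int n)"
proof (induction n rule: less_induct)
  case (less n)
  show ?case
  proof (cases "n \<le> 1")
    case True
    then consider "n = 0" | "n = 1" by linarith
    then show ?thesis
      by cases (auto intro: four_sqI[of _ 0 0 0 0] four_sqI[of _ 1 0 0 0])
  next
    case False
    then obtain p where p: "prime p" "p dvd n" by (metis less_or_eq_imp_le neq_iff prime_factor_nat)
    then obtain m where m: "n = p * m" by blast
    have "m < n" unfolding m by (rule n_less_m_mult_n) (use m False prime_gt_1_nat[OF p(1)] in \<open>auto intro: Nat.gr0I\<close>)
    then show ?thesis using less.IH four_sq_mult[OF four_sq_prime[of "int p"]] p(1) m by simp
  qed
qed

section \<open>Odd primes as values of a quaternary form\<close>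

text \<open>Stated for a list of pairs (coefficient, variable) so that the four squares may be permuted freely.\<close>

definition adapted :: "int \<Rightarrow> bool" where
  "adapted p \<longleftrightarrow> (\<exists>cs :: (int \<times> int) list. image_mset (\<lambda>c. \<bar>fst c\<bar>) (mset cs) = {#1, 5, 3, 2#} \<and>
     p = (\<Sum>c\<leftarrow>cs. (snd c)\<^sup>2) \<and> 13 dvd (\<Sum>c\<leftarrow>cs. fst c * snd c))"

text \<open>Some signed permutations of \<open>(1, 5, 3, 2)\<close>, sufficient for the residues met below.\<close>

definition coeffs13 :: "(int \<times> int \<times> int \<times> int) list" where
  "coeffs13 = [(1, 2, 3, 5), (1, -3, 5, -2), (1, -2, -5, 3), (3, -1, 2, 5), (3, 5, -1, -2),
    (1, 2, -3, -5), (3, 1, 2, -5), (1, 5, 3, -2), (1, 5, -3, 2), (3, 5, 2, -1), (3, -2, 1, -5),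
    (3, -1, -2, -5), (3, -2, 1, 5), (3, -5, -1, 2), (1, -5, -3, -2), (3, 2, -5, -1), (1, 3, -5, -2),
    (1, 2, -3, 5), (3, -1, 2, -5), (3, -5, -2, -1), (1, -5, 3, 2), (1, -5, -3, 2), (1, -5, 2, 3),
    (1, 3, 5, -2)]"

definition hits13 :: "int \<Rightarrow> int \<Rightarrow> int \<Rightarrow> int \<Rightarrow> bool" where
  "hits13 x y z w \<longleftrightarrow> list_ex (\<lambda>(a, b, c, d). (a * x + b * y + c * z + d * w) mod 13 = 0) coeffs13"

lemma hits13_cong:
  assumes "hits13 x y z w" "13 dvd x' - x" "13 dvd y' - y" "13 dvd z' - z" "13 dvd w' - w"
  shows "hits13 x' y' z' w'"
proof -
  have *: "(a * x' + b * y' + c * z' + d * w') mod 13 = (a * x + b * y + c * z + d * w) mod 13" for a b c d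
  proof -
    have "(a * x' + b * y' + c * z' + d * w') - (a * x + b * y + c * z + d * w)
        = a * (x' - x) + b * (y' - y) + c * (z' - z) + d * (w' - w)" by Groebner_Basis.algebra
    then have "13 dvd (a * x' + b * y' + c * z' + d * w') - (a * x + b * y + c * z + d * w)"
      using assms(2-5) by (auto intro!: dvd_add dvd_mult)
    then show ?thesis by (simp add: mod_eq_dvd_iff)
  qed
  show ?thesis using assms(1) unfolding hits13_def * .
qed

lemma adapted_of_hits13:
  assumes "hits13 x y z w" shows "adapted (x\<^sup>2 + y\<^sup>2 + z\<^sup>2 + w\<^sup>2)"
proof -
  obtain a b c d where abcd: "(a, b, c, d) \<in> set coeffs13" "13 dvd a * x + b * y + c * z + d * w"
    using assms unfolding hits13_def list_ex_iff by (auto simp: dvd_eq_mod_eq_0)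
  have "\<forall>(a, b, c, d) \<in> set coeffs13. {#\<bar>a\<bar>, \<bar>b\<bar>, \<bar>c\<bar>, \<bar>d\<bar>#} = {#1, 5, 3, 2#}"
    unfolding coeffs13_def by (simp add: add_mset_commute)
  then have "{#\<bar>a\<bar>, \<bar>b\<bar>, \<bar>c\<bar>, \<bar>d\<bar>#} = {#1, 5, 3, 2#}" using abcd(1) by blast
  then show ?thesis unfolding adapted_def using abcd(2)
    by (intro exI[of _ "[(a, x), (b, y), (c, z), (d, w)]"]) (simp add: add.assoc)
qed

text \<open>Serves to put the pairs of \<open>adapted\<close> into the fixed order 1, 5, 3, 2 of
  absolute coefficients.\<close>

lemma mset_map_eq_reorder:
  "image_mset f (mset xs) = mset ys \<Longrightarrow> \<exists>zs. mset zs = mset xs \<and> map f zs = ys"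
proof (induction ys arbitrary: xs)
  case Nil
  then show ?case by simp
next
  case (Cons y ys)
  then obtain x where x: "x \<in> set xs" "f x = y"
    by (metis image_iff list.set_intros(1) set_image_mset set_mset_mset)
  have "image_mset f (mset (remove1 x xs)) = mset ys"
    using Cons.prems x by (simp add: image_mset_Diff)
  then obtain zs where "mset zs = mset (remove1 x xs)" "map f zs = ys" using Cons.IH by blast
  then show ?case using x by (intro exI[of _ "x # zs"]) (simp add: in_multiset_in_set)
qed

lemma adaptedE:
  assumes "adapted p"
  obtains x y z w where "p = x\<^sup>2 + y\<^sup>2 + z\<^sup>2 + w\<^sup>2" "13 dvd x + 5 * y + 3 * z - 2 * w"
proof -
  obtain cs :: "(int \<times> int) list" where cs: "image_mset (\<lambda>c. \<bar>fst c\<bar>) (mset cs) = {#1, 5, 3, 2#}"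
    "p = (\<Sum>c\<leftarrow>cs. (snd c)\<^sup>2)" "13 dvd (\<Sum>c\<leftarrow>cs. fst c * snd c)"
    using assms unfolding adapted_def by blast
  obtain ds where ds: "mset ds = mset cs" "map (\<lambda>c. \<bar>fst c\<bar>) ds = [1, 5, 3, 2]"
    using mset_map_eq_reorder[of "\<lambda>c. \<bar>fst c\<bar>" cs "[1, 5, 3, 2]"] cs(1) by (metis mset.simps)
  have s: "(\<Sum>c\<leftarrow>ds. h c) = (\<Sum>c\<leftarrow>cs. h c)" for h :: "int \<times> int \<Rightarrow> int"
    using ds(1) by (metis mset_map sum_mset_sum_list)
  obtain a x b y c z d w where d: "ds = [(a, x), (b, y), (c, z), (d, w)]"
    "\<bar>a\<bar> = 1" "\<bar>b\<bar> = 5" "\<bar>c\<bar> = 3" "\<bar>d\<bar> = 2"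
    using ds(2) by (auto simp: map_eq_Cons_conv)
  have sg: "a = sgn a" "b = 5 * sgn b" "c = 3 * sgn c" "d = 2 * sgn d"
    using d(2-5) by (auto simp: sgn_if split: if_splits)
  \<comment> \<open>The signs of the coefficients move into the variables, where squaring hides
    them; \<open>w\<close> gets one more sign because the target coefficient is -2.\<close>
  have sq: "(sgn a * x)\<^sup>2 = x\<^sup>2" "(sgn b * y)\<^sup>2 = y\<^sup>2" "(sgn c * z)\<^sup>2 = z\<^sup>2" "(- sgn d * w)\<^sup>2 = w\<^sup>2"
    using d(2-5) by (auto simp: power_mult_distrib sgn_if)
  have "p = (sgn a * x)\<^sup>2 + (sgn b * y)\<^sup>2 + (sgn c * z)\<^sup>2 + (- sgn d * w)\<^sup>2"
    using cs(2) s[of "\<lambda>c. (snd c)\<^sup>2"] unfolding sq by (simp add: d(1))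
  moreover have "13 dvd sgn a * x + 5 * (sgn b * y) + 3 * (sgn c * z) - 2 * (- sgn d * w)"
  proof -
    have "sgn a * x + 5 * (sgn b * y) + 3 * (sgn c * z) - 2 * (- sgn d * w)
        = a * x + b * y + c * z + d * w"
      by (subst (2) sg(1), subst (2) sg(2), subst (2) sg(3), subst (2) sg(4)) (simp add: algebra_simps)
    then show ?thesis using cs(3) s[of "\<lambda>c. fst c * snd c"] by (simp add: d(1) add.assoc)
  qed
  ultimately show ?thesis by (rule that)
qed

text \<open>This is \<open>(|\<alpha>|\<^sup>2 + 13 |\<beta>|\<^sup>2) / 3\<close> for \<open>\<beta> = c + d i\<close> and \<open>\<alpha> = (1 + i) (c - d i) + 3 (g + h i)\<close>.\<close>

definition frame_form :: "int \<Rightarrow> int \<Rightarrow> int \<Rightarrow> int \<Rightarrow> int" where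
  "frame_form g h c d = 3 * (g\<^sup>2 + h\<^sup>2) + 5 * (c\<^sup>2 + d\<^sup>2) + 2 * g * (c + d) + 2 * h * (c - d)"

text \<open>With \<open>A = x + y i\<close> and \<open>B = z + w i\<close> the solution is \<open>\<beta> = (B + (1 + i) conj A) / (2 + 3 i)\<close> and
  \<open>\<alpha> = A - (1 + i) conj B\<close>, the coordinates of the quaternion product \<open>(1 + (1 + i) j) (A + B j)\<close>.\<close>

lemma frame_form_of_adapted:
  assumes "adapted p"
  obtains g h c d where "p = frame_form g h c d"
proof -
  obtain x y z w where p: "p = x\<^sup>2 + y\<^sup>2 + z\<^sup>2 + w\<^sup>2" and k: "13 dvd x + 5 * y + 3 * z - 2 * w"
    using assms by (rule adaptedE)
  obtain k' where k': "x + 5 * y + 3 * z - 2 * w = 13 * k'" using k by blast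
  then have x: "x = 13 * k' - 5 * y - 3 * z + 2 * w" by simp
  define c d where "c = 5 * k' - 2 * y - z + w" and "d = - k'"
  define g h where "g = 3 * k' - y - z" and "h = y - 2 * k'"
  have "p = frame_form g h c d"
    unfolding p frame_form_def g_def h_def c_def d_def x by Groebner_Basis.algebra
  then show ?thesis by (rule that)
qed

section \<open>Residues of four-square representations modulo 13\<close>

text \<open>Signs and order of the squares are free, so residues from 0 to 6 in increasing order
  suffice and evaluation settles the claim. For sorted entries \<open>a = d\<close> makes all four
  equal. Up to scaling the exceptions are (0, 0, 0, 1), (0, 0, 1, 1) and (1, 1, 1, 1); they are
  genuine, because a signed sum of one, two or all four of the numbers 1, 5, 3, 2 is never 0 modulo
  13.\<close>

lemma hits13_sorted:
  assumes "0 \<le> a" "a \<le> b" "b \<le> c" "c \<le> d" "d \<le> 6" "\<not> 13 dvd a\<^sup>2 + b\<^sup>2 + c\<^sup>2 + d\<^sup>2"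
  shows "hits13 a b c d \<or> a = 0 \<and> b = 0 \<and> (c = 0 \<or> c = d) \<or> a = d"
proof -
  have "list_all (\<lambda>a. list_all (\<lambda>b. list_all (\<lambda>c. list_all (\<lambda>d. (a * a + b * b + c * c + d * d) mod 13 = 0 \<or>
      a = 0 \<and> b = 0 \<and> (c = 0 \<or> c = d) \<or> a = d \<or> hits13 a b c d) [c..6]) [b..6]) [a..6]) [0..6]"
    by code_simp
  then have "\<forall>a\<in>{0..6}. \<forall>b\<in>{a..6}. \<forall>c\<in>{b..6}. \<forall>d\<in>{c..6}. (a * a + b * b + c * c + d * d) mod 13 = 0 \<or>
      a = 0 \<and> b = 0 \<and> (c = 0 \<or> c = d) \<or> a = d \<or> hits13 a b c d"
    unfolding list_all_iff set_upto .
  then have "(a * a + b * b + c * c + d * d) mod 13 = 0 \<or>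
      a = 0 \<and> b = 0 \<and> (c = 0 \<or> c = d) \<or> a = d \<or> hits13 a b c d"
    using assms(1-5) by (meson atLeastAtMost_iff order.trans)
  then show ?thesis using assms(6) by (auto simp: power2_eq_square dvd_eq_mod_eq_0)
qed

text \<open>The residues that the rotations below produce. The first two contain a pair X, 5 X of
  norm 26 X^2, the next two come from rotations with denominator 3, and the last is a quarter of the
  Hadamard transform of (s, 0, X, 5 X), with 10 as the inverse of 4 modulo 13.\<close>

lemma hits13_tables:
  assumes "\<not> 13 dvd s" "\<not> 13 dvd X"
  shows "hits13 s 0 X (5 * X)" "hits13 s s X (5 * X)" "hits13 (4 * s) (- 4 * s) (- 3 * s) 0"
    "hits13 s (2 * s) (2 * s) (3 * s)"
    "hits13 (10 * (s + 6 * X)) (10 * (s - 6 * X)) (10 * (s - 4 * X)) (10 * (s + 4 * X))"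
proof -
  have "list_all (\<lambda>s. list_all (\<lambda>X. hits13 s 0 X (5 * X) \<and> hits13 s s X (5 * X) \<and>
      hits13 (10 * (s + 6 * X)) (10 * (s - 6 * X)) (10 * (s - 4 * X)) (10 * (s + 4 * X))) [1..12] \<and>
      hits13 (4 * s) (- 4 * s) (- 3 * s) 0 \<and> hits13 s (2 * s) (2 * s) (3 * s)) [1..12]"
    by code_simp
  then have *: "\<forall>s\<in>{1..12}. (\<forall>X\<in>{1..12}. hits13 s 0 X (5 * X) \<and> hits13 s s X (5 * X) \<and>
      hits13 (10 * (s + 6 * X)) (10 * (s - 6 * X)) (10 * (s - 4 * X)) (10 * (s + 4 * X))) \<and>
      hits13 (4 * s) (- 4 * s) (- 3 * s) 0 \<and> hits13 s (2 * s) (2 * s) (3 * s)"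
    unfolding list_all_iff set_upto .
  define s' X' where "s' = s mod 13" and "X' = X mod 13"
  have r: "s' \<in> {1..12}" "X' \<in> {1..12}"
    using assms pos_mod_bound[of 13 s] pos_mod_sign[of 13 s] pos_mod_bound[of 13 X] pos_mod_sign[of 13 X]
    unfolding s'_def X'_def dvd_eq_mod_eq_0 atLeastAtMost_iff by linarith+
  have "13 dvd s - s'" "13 dvd X - X'" by (simp_all add: s'_def X'_def minus_mod_eq_mult_div)
  then obtain k l where k: "s = s' + 13 * k" and l: "X = X' + 13 * l"
    by (metis add.commute diff_add_cancel dvdE)
  note h = *[rule_format, OF r(1)]
  have hX: "hits13 s' 0 X' (5 * X')" "hits13 s' s' X' (5 * X')"
      "hits13 (10 * (s' + 6 * X')) (10 * (s' - 6 * X')) (10 * (s' - 4 * X')) (10 * (s' + 4 * X'))"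
    using h r(2) by blast+
  have hs: "hits13 (4 * s') (- 4 * s') (- 3 * s') 0" "hits13 s' (2 * s') (2 * s') (3 * s')" using h by blast+
  show "hits13 s 0 X (5 * X)" by (rule hits13_cong[OF hX(1)]) (simp_all add: k l algebra_simps)
  show "hits13 s s X (5 * X)" by (rule hits13_cong[OF hX(2)]) (simp_all add: k l algebra_simps)
  show "hits13 (10 * (s + 6 * X)) (10 * (s - 6 * X)) (10 * (s - 4 * X)) (10 * (s + 4 * X))"
    by (rule hits13_cong[OF hX(3)]) (auto simp: k l algebra_simps)
  show "hits13 (4 * s) (- 4 * s) (- 3 * s) 0" by (rule hits13_cong[OF hs(1)]) (simp_all add: k l algebra_simps)
  show "hits13 s (2 * s) (2 * s) (3 * s)" by (rule hits13_cong[OF hs(2)]) (simp_all add: k l algebra_simps)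
qed

lemma adapted_or_special:
  assumes "p = x\<^sup>2 + y\<^sup>2 + z\<^sup>2 + w\<^sup>2" "\<not> 13 dvd p"
  obtains "adapted p"
  | a b c d where "p = a\<^sup>2 + b\<^sup>2 + c\<^sup>2 + d\<^sup>2" "13 dvd b" "13 dvd c" "13 dvd d"
  | a b c d where "p = a\<^sup>2 + b\<^sup>2 + c\<^sup>2 + d\<^sup>2" "13 dvd a - b" "13 dvd c" "13 dvd d"
  | a b c d where "p = a\<^sup>2 + b\<^sup>2 + c\<^sup>2 + d\<^sup>2" "13 dvd a - b" "13 dvd a - c" "13 dvd a - d"
proof -
  have sgn_choice: "\<exists>x'. x'\<^sup>2 = x\<^sup>2 \<and> x' mod 13 \<le> 6" for x :: int
  proof (cases "x mod 13 \<le> 6")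
    case False
    then have "(- x) mod 13 \<le> 6" by (simp add: zmod_zminus1_eq_if)
    then show ?thesis by (intro exI[of _ "- x"]) simp
  qed blast
  obtain x' y' z' w' where s: "x'\<^sup>2 = x\<^sup>2" "x' mod 13 \<le> 6" "y'\<^sup>2 = y\<^sup>2" "y' mod 13 \<le> 6"
      "z'\<^sup>2 = z\<^sup>2" "z' mod 13 \<le> 6" "w'\<^sup>2 = w\<^sup>2" "w' mod 13 \<le> 6"
    using sgn_choice by metis
  define l where "l = sort_key (\<lambda>x. x mod 13) [x', y', z', w']"
  have "length l = 4" by (simp add: l_def)
  then obtain a b c d where l: "l = [a, b, c, d]"
    by (auto simp: numeral_eq_Suc length_Suc_conv)
  have ms: "mset l = mset [x', y', z', w']" by (simp add: l_def)
  then have "sum_list (map (\<lambda>x. x\<^sup>2) l) = sum_list (map (\<lambda>x. x\<^sup>2) [x', y', z', w'])"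
    by (metis mset_map sum_mset_sum_list)
  then have p: "p = a\<^sup>2 + b\<^sup>2 + c\<^sup>2 + d\<^sup>2" using s assms(1) by (simp add: l)
  have "sorted (map (\<lambda>x. x mod 13) l)" unfolding l_def by (rule sorted_sort_key)
  then have ord: "a mod 13 \<le> b mod 13" "b mod 13 \<le> c mod 13" "c mod 13 \<le> d mod 13" by (auto simp: l)
  have "set l = {x', y', z', w'}" using ms by (metis set_mset_mset list.set(1) list.simps(15))
  then have "d mod 13 \<le> 6" using s by (auto simp: l)
  moreover have "\<not> 13 dvd (a mod 13)\<^sup>2 + (b mod 13)\<^sup>2 + (c mod 13)\<^sup>2 + (d mod 13)\<^sup>2"
  proof -
    have "((a mod 13)\<^sup>2 + (b mod 13)\<^sup>2 + (c mod 13)\<^sup>2 + (d mod 13)\<^sup>2) mod 13 = (a\<^sup>2 + b\<^sup>2 + c\<^sup>2 + d\<^sup>2) mod 13"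
      by (intro mod_add_cong) (simp_all add: power_mod)
    then show ?thesis using assms(2) unfolding p dvd_eq_mod_eq_0 by simp
  qed
  ultimately consider "hits13 (a mod 13) (b mod 13) (c mod 13) (d mod 13)"
    | "a mod 13 = 0" "b mod 13 = 0" "c mod 13 = 0" | "a mod 13 = 0" "b mod 13 = 0" "c mod 13 = d mod 13"
    | "a mod 13 = d mod 13"
    using hits13_sorted[OF _ ord] by auto
  then show ?thesis
  proof cases
    case 1
    have "hits13 a b c d" by (rule hits13_cong[OF 1]) (simp_all add: mod_eq_dvd_iff flip: minus_mod_eq_mult_div)
    then show ?thesis using adapted_of_hits13 p that(1) by blast
  next
    case 2
    then show ?thesis by (intro that(2)[of d a b c]) (auto simp: p dvd_eq_mod_eq_0)
  next
    case 3
    then show ?thesis by (intro that(3)[of c d a b]) (auto simp: p dvd_eq_mod_eq_0 mod_eq_dvd_iff)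
  next
    case 4
    then have "a mod 13 = b mod 13" "a mod 13 = c mod 13" using ord by linarith+
    then show ?thesis using 4 by (intro that(4)[OF p] mod_eq_dvd_iff[THEN iffD1])
  qed
qed

text \<open>The point \<open>13 (b + c i)\<close> is rotated by a power of \<open>(2 + 3 i)\<^sup>2 / 13\<close> or of its conjugate.\<close>

lemma rotate13:
  fixes b c :: int
  assumes "b \<noteq> 0 \<or> c \<noteq> 0"
  shows "\<exists>X Y. X\<^sup>2 + Y\<^sup>2 = 169 * (b\<^sup>2 + c\<^sup>2) \<and> \<not> 13 dvd X \<and> even (X - b) \<and> even (Y - c)"
  using assms
proof (induction "nat \<bar>b\<bar> + nat \<bar>c\<bar>" arbitrary: b c rule: less_induct)
  case less
  have step: "\<exists>X Y. X\<^sup>2 + Y\<^sup>2 = 169 * (u\<^sup>2 + v\<^sup>2) \<and> \<not> 13 dvd X \<and> even (X - u) \<and> even (Y - v)"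
    if not: "\<not> (13 dvd u \<and> 13 dvd v)" for u v :: int
  proof -
    have *: "13 dvd u \<and> 13 dvd v" if "13 dvd - 5 * u - 12 * v" "13 dvd - 5 * u + 12 * v"
    proof -
      have "13 dvd - 10 * u" "13 dvd - 24 * v" using dvd_add[OF that] dvd_diff[OF that] by simp_all
      then show ?thesis by presburger
    qed
    show ?thesis
    proof (cases "13 dvd - 5 * u - 12 * v")
      case False
      \<comment> \<open>The product of u + v i with (2 + 3 i)^2 = -5 + 12 i. Since 5 is odd and 12
        even, the parities of u and v survive.\<close>
      have "(- 5 * u - 12 * v)\<^sup>2 + (12 * u - 5 * v)\<^sup>2 = 169 * (u\<^sup>2 + v\<^sup>2)" by Groebner_Basis.algebra
      then show ?thesis using False by (intro exI[of _ "- 5 * u - 12 * v"] exI[of _ "12 * u - 5 * v"]) auto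
    next
      case True
      then have "\<not> 13 dvd - 5 * u + 12 * v" using * not by metis
      moreover have "(- 5 * u + 12 * v)\<^sup>2 + (- 12 * u - 5 * v)\<^sup>2 = 169 * (u\<^sup>2 + v\<^sup>2)" by Groebner_Basis.algebra
      ultimately show ?thesis by (intro exI[of _ "- 5 * u + 12 * v"] exI[of _ "- 12 * u - 5 * v"]) auto
    qed
  qed
  show ?case
  proof (cases "13 dvd b \<and> 13 dvd c")
    case False
    then show ?thesis by (rule step)
  next
    case True
    then obtain b' c' where bc: "b = 13 * b'" "c = 13 * c'" by blast
    have "nat \<bar>b'\<bar> + nat \<bar>c'\<bar> < nat \<bar>b\<bar> + nat \<bar>c\<bar>" "b' \<noteq> 0 \<or> c' \<noteq> 0"
      using less.prems by (auto simp: bc)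
    then obtain u v where uv: "u\<^sup>2 + v\<^sup>2 = 169 * (b'\<^sup>2 + c'\<^sup>2)" "\<not> 13 dvd u" "even (u - b')" "even (v - c')"
      using less.hyps by blast
    then obtain X Y where "X\<^sup>2 + Y\<^sup>2 = 169 * (u\<^sup>2 + v\<^sup>2)" "\<not> 13 dvd X" "even (X - u)" "even (Y - v)"
      using step by blast
    then show ?thesis using uv by (intro exI[of _ X] exI[of _ Y]) (auto simp: bc power_mult_distrib)
  qed
qed

text \<open>The square roots of -1 modulo 13 are 5 and -5, and the sign of Y is free. The parity
  clause is for the halving steps in \<open>adapted_four\<close>.\<close>

lemma dvd13_sum_squaresE:
  fixes X Y :: int
  assumes "13 dvd X\<^sup>2 + Y\<^sup>2"
  obtains Z where "Z\<^sup>2 = Y\<^sup>2" "13 dvd Z - 5 * X" "even (Z - Y)"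
proof -
  have "(Y - 5 * X) * (Y + 5 * X) = (X\<^sup>2 + Y\<^sup>2) - 13 * (2 * X\<^sup>2)" by Groebner_Basis.algebra
  then have "13 dvd (Y - 5 * X) * (Y + 5 * X)" using assms by (metis dvd_diff dvd_triv_left)
  moreover have "prime (13 :: int)" by simp
  ultimately consider "13 dvd Y - 5 * X" | "13 dvd Y + 5 * X" using prime_dvd_multD by blast
  then show ?thesis
  proof cases
    case 1
    then show ?thesis by (intro that[of Y]) auto
  next
    case 2
    moreover have "- Y - 5 * X = - (Y + 5 * X)" by simp
    ultimately have "13 dvd - Y - 5 * X" by (metis dvd_minus_iff)
    then show ?thesis by (intro that[of "- Y"]) auto
  qed
qed

section \<open>Changing the exceptional representations\<close>

text \<open>The pair (13 b, 13 c) is rotated to a pair of the same norm with residues X, 5 X prime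
  to 13, and the residue vector (s, 0, X, 5 X) is no longer exceptional. \<open>adapted_two\<close>
  does the same for (s, s, 0, 0).\<close>

lemma adapted_one:
  assumes "p = s\<^sup>2 + t\<^sup>2 + (13 * b)\<^sup>2 + (13 * c)\<^sup>2" "13 dvd t" "\<not> 13 dvd s" "b \<noteq> 0 \<or> c \<noteq> 0"
  shows "adapted p"
proof -
  obtain X Y where XY: "X\<^sup>2 + Y\<^sup>2 = 169 * (b\<^sup>2 + c\<^sup>2)" "\<not> 13 dvd X" using rotate13[OF assms(4)] by blast
  have "13 dvd X\<^sup>2 + Y\<^sup>2" unfolding XY by simp
  then obtain Z where Z: "Z\<^sup>2 = Y\<^sup>2" "13 dvd Z - 5 * X" by (rule dvd13_sum_squaresE)
  have "hits13 s t X Z" by (rule hits13_cong[OF hits13_tables(1)[OF assms(3) XY(2)]]) (use assms(2) Z(2) in auto)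
  moreover have "p = s\<^sup>2 + t\<^sup>2 + X\<^sup>2 + Z\<^sup>2" using XY(1) assms(1) Z(1) by (simp add: power_mult_distrib)
  ultimately show ?thesis using adapted_of_hits13 by blast
qed

lemma adapted_two:
  assumes "p = s\<^sup>2 + t\<^sup>2 + (13 * b)\<^sup>2 + (13 * c)\<^sup>2" "13 dvd s - t" "\<not> 13 dvd s" "b \<noteq> 0 \<or> c \<noteq> 0"
  shows "adapted p"
proof -
  obtain X Y where XY: "X\<^sup>2 + Y\<^sup>2 = 169 * (b\<^sup>2 + c\<^sup>2)" "\<not> 13 dvd X" using rotate13[OF assms(4)] by blast
  have "13 dvd X\<^sup>2 + Y\<^sup>2" unfolding XY by simp
  then obtain Z where Z: "Z\<^sup>2 = Y\<^sup>2" "13 dvd Z - 5 * X" by (rule dvd13_sum_squaresE)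
  have "13 dvd t - s" using assms(2) by (simp add: dvd_diff_commute)
  then have "hits13 s t X Z" by (intro hits13_cong[OF hits13_tables(2)[OF assms(3) XY(2)]]) (use Z(2) in auto)
  moreover have "p = s\<^sup>2 + t\<^sup>2 + X\<^sup>2 + Z\<^sup>2" using XY(1) assms(1) Z(1) by (simp add: power_mult_distrib)
  ultimately show ?thesis using adapted_of_hits13 by blast
qed

text \<open>With the other two coordinates equal to 0 there is nothing to rotate modulo 13. But 3
  divides one of x, y, x - y, x + y, and this allows a rotation with denominator 3 that fills
  further coordinates. Oddness of p excludes x = y.\<close>

lemma adapted_two_squares:
  assumes "p = x\<^sup>2 + y\<^sup>2" "13 dvd x - y" "\<not> 13 dvd p" "odd p"
  shows "adapted p"
proof -
  have nx: "\<not> 13 dvd x"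
  proof
    assume x: "13 dvd x"
    have "13 dvd y" using dvd_diff[OF x assms(2)] by simp
    then show False using x assms(1,3) by (simp add: power2_eq_square)
  qed
  then have ny: "\<not> 13 dvd y" using assms(2) by (metis dvd_add diff_add_cancel)
  have div3: "adapted p" if "p = (3 * m)\<^sup>2 + v\<^sup>2" "13 dvd 3 * m - v" "\<not> 13 dvd v" for m v
  proof -
    have "\<not> 13 dvd m"
    proof
      assume "13 dvd m"
      then have "13 dvd 3 * m - (3 * m - v)" by (intro dvd_diff that(2)) simp
      then show False using that(3) by simp
    qed
    then have "hits13 m (2 * m) (2 * m) v"
      by (intro hits13_cong[OF hits13_tables(4)]) (use that(2) in \<open>auto simp: dvd_diff_commute\<close>)
    \<comment> \<open>From 3^2 = 1^2 + 2^2 + 2^2.\<close>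
    moreover have "p = m\<^sup>2 + (2 * m)\<^sup>2 + (2 * m)\<^sup>2 + v\<^sup>2" unfolding that(1) by Groebner_Basis.algebra
    ultimately show ?thesis using adapted_of_hits13 by blast
  qed
  consider m where "x = 3 * m" | m where "y = 3 * m" | m where "x - y = 3 * m" | m where "x + y = 3 * m"
  proof -
    have "3 dvd x \<or> 3 dvd y \<or> 3 dvd x - y \<or> 3 dvd x + y" by presburger
    then show ?thesis using that by (auto elim!: dvdE)
  qed
  then show ?thesis
  proof cases
    case 1
    then show ?thesis using div3[of m y] assms ny by simp
  next
    case 2
    then show ?thesis using div3[of m x] assms nx by (simp add: add.commute dvd_diff_commute)
  next
    case 3
    then have y: "y = x - 3 * m" by simp
    have "13 dvd 3 * m" using assms(2) unfolding y by simp
    then have "13 dvd m" by presburger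
    then obtain k where k: "m = 13 * k" by blast
    have "m \<noteq> 0" using assms(1,4) y by auto
    \<comment> \<open>The shifts by 2 m lower the sum of the two squares by 4 m^2, which becomes the
      square of a new coordinate 2 m = 26 k. This one is nonzero and divisible by 13, so the
      rotation of \<open>adapted_two\<close> applies.\<close>
    have "p = (x - 2 * m)\<^sup>2 + (y + 2 * m)\<^sup>2 + (13 * (2 * k))\<^sup>2 + (13 * 0)\<^sup>2"
      unfolding assms(1) y k by (simp add: power2_eq_square algebra_simps)
    then show ?thesis
    proof (rule adapted_two)
      show "13 dvd (x - 2 * m) - (y + 2 * m)" by (simp add: y k)
      have "x = (x - 2 * m) + 13 * (2 * k)" by (simp add: k)
      then show "\<not> 13 dvd x - 2 * m" using nx by (metis dvd_add dvd_triv_left)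
      show "2 * k \<noteq> 0 \<or> (0 :: int) \<noteq> 0" using \<open>m \<noteq> 0\<close> k by simp
    qed
  next
    case 4
    then have y: "y = 3 * m - x" by simp
    have "p = (x - 2 * m)\<^sup>2 + (2 * m - y)\<^sup>2 + (2 * m)\<^sup>2 + 0\<^sup>2"
      unfolding assms(1) y by (simp add: power2_eq_square algebra_simps)
    moreover have "hits13 (x - 2 * m) (2 * m - y) (2 * m) 0"
    \<comment> \<open>From x = y and x + y = 3 m modulo 13 follows m = 5 x, which gives the residues
      4 x, -4 x, -3 x, 0.\<close>
    proof (rule hits13_cong[OF hits13_tables(3)[OF nx nx]])
      obtain k where "x - y = 13 * k" using assms(2) by blast
      then have x: "2 * x = 3 * m + 13 * k" using y by simp
      have "x - 2 * m - 4 * x = 13 * (- 3 * x + 18 * k + 4 * m)" using x by Groebner_Basis.algebra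
      then show "13 dvd x - 2 * m - 4 * x" by (metis dvd_triv_left)
      have "2 * m - y - - 4 * x = 13 * (- x + 9 * k + 2 * m)" using x y by Groebner_Basis.algebra
      then show "13 dvd 2 * m - y - - 4 * x" by (metis dvd_triv_left)
      have "2 * m - - 3 * x = 13 * (3 * x - 18 * k - 4 * m)" using x by Groebner_Basis.algebra
      then show "13 dvd 2 * m - - 3 * x" by (metis dvd_triv_left)
    qed simp
    ultimately show ?thesis using adapted_of_hits13 by metis
  qed
qed

text \<open>The Hadamard transform turns residues (x, x, x, x) into one entry prime to 13 and three
  divisible by 13. Two of these are rotated and the transform is undone. Undoing it within the
  integers needs 4 to divide s + A + X + Z: all four are odd because p is odd, so a change of the
  sign of s alters the sum by 2 modulo 4.\<close>

lemma adapted_four: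
  assumes p: "p = x\<^sup>2 + y\<^sup>2 + z\<^sup>2 + w\<^sup>2" and "13 dvd x - y" "13 dvd x - z" "13 dvd x - w"
    and "\<not> 13 dvd p" "odd p"
  shows "adapted p"
proof -
  have "odd (x + y + z + w)" using assms(6) unfolding p by auto
  have nx: "\<not> 13 dvd x"
  proof
    assume x: "13 dvd x"
    have "13 dvd y" "13 dvd z" "13 dvd w"
      using dvd_diff[OF x assms(2)] dvd_diff[OF x assms(3)] dvd_diff[OF x assms(4)] by simp_all
    then show False using x p assms(5) by (simp add: power2_eq_square)
  qed
  obtain i j k where "x - y = 13 * i" "x - z = 13 * j" "x - w = 13 * k"
    using assms(2-4) by (elim dvdE)
  then have ijk: "y = x - 13 * i" "z = x - 13 * j" "w = x - 13 * k" by simp_all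
  have "x - y + z - w = 13 * (i - j + k)" "x - y - z + w = 13 * (i + j - k)" by (simp_all add: ijk)
  then obtain b c where bc: "x - y + z - w = 13 * b" "x - y - z + w = 13 * c" by blast
  have "odd (13 * b)" "odd (13 * c)"
    unfolding bc[symmetric] using \<open>odd (x + y + z + w)\<close> by auto
  then have "odd b" "odd c" by simp_all
  then have "b \<noteq> 0 \<or> c \<noteq> 0" by auto
  then obtain X Y where XY: "X\<^sup>2 + Y\<^sup>2 = 169 * (b\<^sup>2 + c\<^sup>2)" "\<not> 13 dvd X" "even (X - b)" "even (Y - c)"
    using rotate13[of b c] by blast
  have "13 dvd X\<^sup>2 + Y\<^sup>2" unfolding XY by simp
  then obtain Z where Z: "Z\<^sup>2 = Y\<^sup>2" "13 dvd Z - 5 * X" "even (Z - Y)" by (rule dvd13_sum_squaresE)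
  define A where "A = x + y - z - w"
  have odd: "odd X" "odd Z" "odd A"
  proof -
    show "odd X" using \<open>odd b\<close> XY(3) by simp
    show "odd Z" using \<open>odd c\<close> XY(4) Z(3) by simp
    show "odd A" using \<open>odd (x + y + z + w)\<close> by (simp add: A_def)
  qed
  have ns: "\<not> 13 dvd x + y + z + w"
  proof
    assume "13 dvd x + y + z + w"
    moreover have "x + y + z + w = 4 * x - 13 * (i + j + k)" by (simp add: ijk)
    ultimately have "13 dvd 4 * x - 13 * (i + j + k)" by metis
    then have "13 dvd 4 * x" by (metis dvd_add dvd_triv_left diff_add_cancel)
    then show False using nx by presburger
  qed
  obtain s where s: "s\<^sup>2 = (x + y + z + w)\<^sup>2" "4 dvd s + A + X + Z" "\<not> 13 dvd s"
  proof (cases "4 dvd (x + y + z + w) + A + X + Z")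
    case True
    show ?thesis by (rule that[OF refl True ns])
  next
    case False
    define S T where "S = x + y + z + w" and "T = A + X + Z"
    have "odd S" using \<open>odd (x + y + z + w)\<close> by (simp add: S_def)
    moreover have "odd T" using odd by (simp add: T_def)
    moreover have "\<not> 4 dvd S + T" using False by (simp add: S_def T_def add.assoc)
    ultimately have "4 dvd - S + T" by presburger
    then have 1: "4 dvd - S + A + X + Z" unfolding T_def by (simp only: add.assoc)
    have 2: "(- S)\<^sup>2 = (x + y + z + w)\<^sup>2" unfolding S_def by (rule power2_minus)
    have 3: "\<not> 13 dvd - S" using ns unfolding S_def by (simp only: dvd_minus_iff not_False_eq_True)
    show ?thesis by (rule that[OF 2 1 3])
  qed
  obtain q where q: "s + A + X + Z = 4 * q" using s(2) by blast
  have "even (X + Z)" "even (A + Z)" "even (A + X)" using odd by simp_all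
  then obtain r t u where r: "X + Z = 2 * r" and t: "A + Z = 2 * t" and u: "A + X = 2 * u"
    by (elim evenE)
  have d: "A = 13 * (j + k - i)" by (simp add: A_def ijk)
  have "4 * p = (x + y + z + w)\<^sup>2 + A\<^sup>2 + (x - y + z - w)\<^sup>2 + (x - y - z + w)\<^sup>2"
    unfolding p A_def by Groebner_Basis.algebra
  also have "\<dots> = s\<^sup>2 + A\<^sup>2 + X\<^sup>2 + Z\<^sup>2"
    unfolding bc using XY(1) Z(1) s(1) by (simp add: power_mult_distrib)
  finally have p4: "4 * p = s\<^sup>2 + A\<^sup>2 + X\<^sup>2 + Z\<^sup>2" .
  have e: "X = 2 * r - Z" "A = 2 * t - Z" "u = r + t - Z" "s = 4 * q - 2 * r - 2 * t + Z"
    using r t u q by auto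
  have "4 * p = 4 * (q\<^sup>2 + (q - r)\<^sup>2 + (q - t)\<^sup>2 + (q - u)\<^sup>2)"
    unfolding p4 e by Groebner_Basis.algebra
  then have "p = q\<^sup>2 + (q - r)\<^sup>2 + (q - t)\<^sup>2 + (q - u)\<^sup>2" by simp
  moreover have "hits13 q (q - r) (q - t) (q - u)"
  proof (rule hits13_cong[OF hits13_tables(5)[OF s(3) XY(2)]])
    obtain m where m: "Z = 5 * X + 13 * m" using Z(2) by (metis dvdE diff_add_cancel add.commute)
    have "q - 10 * (s + 6 * X) = 13 * (- 3 * q + 10 * (j + k - i) + 10 * m)" using q d m by Groebner_Basis.algebra
    then show "13 dvd q - 10 * (s + 6 * X)" by (metis dvd_triv_left)
    have "q - r - 10 * (s - 6 * X) = 13 * (- 3 * q + 6 * X + r + 3 * m + 10 * (j + k - i))" using q r d m by Groebner_Basis.algebra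
    then show "13 dvd q - r - 10 * (s - 6 * X)" by (metis dvd_triv_left)
    have "q - t - 10 * (s - 4 * X) = 13 * (- 3 * q + 5 * X + 3 * (j + k - i) + 3 * m + t)" using q t d m by Groebner_Basis.algebra
    then show "13 dvd q - t - 10 * (s - 4 * X)" by (metis dvd_triv_left)
    have "q - u - 10 * (s + 4 * X) = 13 * (- 3 * q + X + 3 * (j + k - i) + 10 * m + u)" using q u d m by Groebner_Basis.algebra
    then show "13 dvd q - u - 10 * (s + 4 * X)" by (metis dvd_triv_left)
  qed
  ultimately show ?thesis using adapted_of_hits13 by blast
qed

theorem prime_frame_form:
  fixes p :: int
  assumes "prime p" "odd p"
  obtains g h c d where "p = frame_form g h c d"
proof (cases "p = 13")
  case True
  then show ?thesis by (intro that[of 0 "- 2" 1 0]) (simp add: frame_form_def)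
next
  case False
  have "prime (13 :: int)" by simp
  then have n13: "\<not> 13 dvd p" using assms(1) False primes_dvd_imp_eq[of 13 p] by blast
  have nsq: "p \<noteq> x\<^sup>2" for x using assms(1) by (metis prime_power_iff numeral_eq_one_iff semiring_norm(85))
  obtain x y z w where "p = x\<^sup>2 + y\<^sup>2 + z\<^sup>2 + w\<^sup>2" using four_sq_prime[OF assms(1)] unfolding four_sq_def by blast
  then consider "adapted p"
    | a b c d where "p = a\<^sup>2 + b\<^sup>2 + c\<^sup>2 + d\<^sup>2" "13 dvd b" "13 dvd c" "13 dvd d"
    | a b c d where "p = a\<^sup>2 + b\<^sup>2 + c\<^sup>2 + d\<^sup>2" "13 dvd a - b" "13 dvd c" "13 dvd d"
    | a b c d where "p = a\<^sup>2 + b\<^sup>2 + c\<^sup>2 + d\<^sup>2" "13 dvd a - b" "13 dvd a - c" "13 dvd a - d"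
    by (rule adapted_or_special[OF _ n13])
  then have "adapted p"
  proof cases
    case (2 a b c d)
    then obtain b' c' d' where bcd: "b = 13 * b'" "c = 13 * c'" "d = 13 * d'" by (metis dvdE)
    have "\<not> 13 dvd a" using n13 2 by (auto simp: power2_eq_square)
    \<comment> \<open>One of \<open>b'\<close>, \<open>c'\<close>, \<open>d'\<close> is nonzero
      because a prime is not a square; it has to belong to the pair that is rotated.\<close>
    show ?thesis
    proof (cases "c' = 0 \<and> d' = 0")
      case True
      then have "b' \<noteq> 0" using 2(1) nsq[of a] bcd by auto
      then show ?thesis using adapted_one[of p a c b' d'] 2 bcd \<open>\<not> 13 dvd a\<close> by (simp add: ac_simps)
    next
      case False
      then show ?thesis using adapted_one[of p a b c' d'] 2 bcd \<open>\<not> 13 dvd a\<close> by simp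
    qed
  next
    case (3 a b c d)
    then obtain c' d' where cd: "c = 13 * c'" "d = 13 * d'" by (metis dvdE)
    show ?thesis
    proof (cases "c' = 0 \<and> d' = 0")
      case True
      then show ?thesis using adapted_two_squares[of p a b] 3 cd n13 assms(2) by simp
    next
      case False
      have "\<not> 13 dvd a"
      proof
        assume "13 dvd a"
        then have "13 dvd b" using dvd_diff[OF _ 3(2), of a] by simp
        then show False using \<open>13 dvd a\<close> 3 n13 by (simp add: power2_eq_square)
      qed
      then show ?thesis using adapted_two[of p a b c' d'] 3 cd False by simp
    qed
  next
    case (4 a b c d)
    then show ?thesis using adapted_four n13 assms(2) by blast
  qed
  then show ?thesis using frame_form_of_adapted that by blast
qed

section \<open>Frames in integral lattices\<close>

definition ip :: "(nat \<Rightarrow> int) \<Rightarrow> (nat \<Rightarrow> int) \<Rightarrow> int" where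
  "ip x y = (\<Sum>t<28. x t * y t)"

text \<open>The integer vectors that reduce modulo \<open>k\<close> to the code with generator matrix \<open>(I  G)\<close> and to its dual;
  the two coincide when \<open>G G\<^sup>T = - I\<close> modulo \<open>k\<close>.\<close>

definition code_lattice :: "int \<Rightarrow> (nat \<Rightarrow> nat \<Rightarrow> int) \<Rightarrow> (nat \<Rightarrow> int) set" where
  "code_lattice k G = {x. (\<forall>j<14. k dvd x (14 + j) - (\<Sum>i<14. x i * G i j)) \<and>
                 (\<forall>i<14. k dvd x i + (\<Sum>j<14. x (14 + j) * G i j))}"

definition zframe :: "int \<Rightarrow> (nat \<Rightarrow> int) set \<Rightarrow> (nat \<Rightarrow> nat \<Rightarrow> int) \<Rightarrow> bool" where
  "zframe m L f \<longleftrightarrow> (\<forall>i<28. f i \<in> L) \<and> (\<forall>i<28. \<forall>j<28. ip (f i) (f j) = (if i = j then m else 0))"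

lemma ip_commute: "ip x y = ip y x"
  by (simp add: ip_def mult.commute)

lemma ip_sum_left: "ip (\<lambda>t. \<Sum>s\<in>S. c s * f s t) y = (\<Sum>s\<in>S. c s * ip (f s) y)"
  unfolding ip_def sum_distrib_left sum_distrib_right by (subst sum.swap) (simp add: mult.assoc)

lemma ip_sum_right: "ip y (\<lambda>t. \<Sum>s\<in>S. c s * f s t) = (\<Sum>s\<in>S. c s * ip y (f s))"
  using ip_sum_left[of c f S y] by (simp add: ip_commute)

lemma ip_add_left: "ip (\<lambda>t. x t + y t) z = ip x z + ip y z"
  by (simp add: ip_def sum.distrib algebra_simps)

lemma ip_scale_left: "ip (\<lambda>t. c * x t) z = c * ip x z"
  by (simp add: ip_def sum_distrib_left mult.assoc)

lemma ip_add_right: "ip z (\<lambda>t. x t + y t) = ip z x + ip z y"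
  by (simp add: ip_def sum.distrib algebra_simps)

lemma ip_scale_right: "ip z (\<lambda>t. c * x t) = c * ip z x"
  by (simp add: ip_def sum_distrib_left mult_ac)

lemmas ip_linear = ip_add_left ip_add_right ip_scale_left ip_scale_right

lemma ip_cong: "(\<And>t. t < 28 \<Longrightarrow> x t = x' t) \<Longrightarrow> (\<And>t. t < 28 \<Longrightarrow> y t = y' t) \<Longrightarrow> ip x y = ip x' y'"
  by (simp add: ip_def)

lemma sum_28: "(\<Sum>t<28. f t) = (\<Sum>i<14. f i) + (\<Sum>j<14. f (14 + j))" for f :: "nat \<Rightarrow> int"
proof -
  have "(\<Sum>t<28. f t) = sum f {..<14} + sum f {14..<28}"
    using sum.atLeastLessThan_concat[of 0 14 28 f] by (simp add: atLeast0LessThan)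
  also have "sum f {14..<28} = (\<Sum>j<14. f (14 + j))"
    using sum.shift_bounds_nat_ivl[of f 0 14 14] by (simp add: atLeast0LessThan add.commute)
  finally show ?thesis .
qed

lemma code_lattice_add: "x \<in> code_lattice k G \<Longrightarrow> y \<in> code_lattice k G \<Longrightarrow> (\<lambda>t. x t + y t) \<in> code_lattice k G"
proof -
  assume xy: "x \<in> code_lattice k G" "y \<in> code_lattice k G"
  have 1: "x (14 + j) + y (14 + j) - (\<Sum>i<14. (x i + y i) * G i j) =
      (x (14 + j) - (\<Sum>i<14. x i * G i j)) + (y (14 + j) - (\<Sum>i<14. y i * G i j))" for j
    by (simp add: algebra_simps sum.distrib)
  have 2: "x i + y i + (\<Sum>j<14. (x (14 + j) + y (14 + j)) * G i j) =
      (x i + (\<Sum>j<14. x (14 + j) * G i j)) + (y i + (\<Sum>j<14. y (14 + j) * G i j))" for i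
    by (simp add: algebra_simps sum.distrib)
  show ?thesis using xy unfolding code_lattice_def mem_Collect_eq 1 2 by (auto intro!: dvd_add)
qed

lemma code_lattice_scale: "x \<in> code_lattice k G \<Longrightarrow> (\<lambda>t. c * x t) \<in> code_lattice k G"
proof -
  assume x: "x \<in> code_lattice k G"
  have 1: "c * x (14 + j) - (\<Sum>i<14. c * x i * G i j) = c * (x (14 + j) - (\<Sum>i<14. x i * G i j))" for j
    by (simp add: right_diff_distrib sum_distrib_left mult.assoc)
  have 2: "c * x i + (\<Sum>j<14. c * x (14 + j) * G i j) = c * (x i + (\<Sum>j<14. x (14 + j) * G i j))" for i
    by (simp add: distrib_left sum_distrib_left mult.assoc)
  show ?thesis using x unfolding code_lattice_def mem_Collect_eq 1 2 by (auto intro!: dvd_mult)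
qed

lemma code_lattice_sum: "(\<And>s. s \<in> S \<Longrightarrow> f s \<in> code_lattice k G) \<Longrightarrow> (\<lambda>t. \<Sum>s\<in>S. c s * f s t) \<in> code_lattice k G"
proof (induction S rule: infinite_finite_induct)
  case (insert s S)
  then show ?case using code_lattice_add[OF code_lattice_scale[of "f s" k G "c s"]] by simp
qed (simp_all add: code_lattice_def)

text \<open>Here \<open>y\<close> counts as a code word and \<open>x\<close> as a word of the dual
  code; the double sum of x (14 + j) * y i * G i j links the two conditions.\<close>

lemma dvd_ip_code_lattice:
  assumes "x \<in> code_lattice k G" "y \<in> code_lattice k G"
  shows "k dvd ip x y"
proof -
  have "ip x y = (\<Sum>i<14. x i * y i) + (\<Sum>j<14. x (14 + j) * y (14 + j))"
    unfolding ip_def sum_28 ..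
  also have "\<dots> = (\<Sum>j<14. x (14 + j) * (y (14 + j) - (\<Sum>i<14. y i * G i j))) +
      (\<Sum>i<14. x i * y i) + (\<Sum>j<14. \<Sum>i<14. x (14 + j) * (y i * G i j))"
    by (simp add: right_diff_distrib sum_subtractf sum_distrib_left)
  also have "(\<Sum>j<14. \<Sum>i<14. x (14 + j) * (y i * G i j)) = (\<Sum>i<14. y i * (\<Sum>j<14. x (14 + j) * G i j))"
    by (subst sum.swap) (simp add: sum_distrib_left mult_ac)
  finally have "ip x y = (\<Sum>j<14. x (14 + j) * (y (14 + j) - (\<Sum>i<14. y i * G i j))) +
      (\<Sum>i<14. y i * (x i + (\<Sum>j<14. x (14 + j) * G i j)))"
    by (simp add: distrib_left sum.distrib mult.commute)
  moreover have "k dvd (\<Sum>j<14. x (14 + j) * (y (14 + j) - (\<Sum>i<14. y i * G i j)))"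
    using assms(2) by (intro dvd_sum dvd_mult) (simp add: code_lattice_def)
  moreover have "k dvd (\<Sum>i<14. y i * (x i + (\<Sum>j<14. x (14 + j) * G i j)))"
    using assms(1) by (intro dvd_sum dvd_mult) (simp add: code_lattice_def)
  ultimately show ?thesis by simp
qed

text \<open>Multiplying the relation x_2 = x_1 G between the two halves by G^T gives x_2 G^T = - x_1
  modulo k, which is the dual condition.\<close>

lemma code_lattice_of_first_half:
  assumes G: "\<And>i l. i < 14 \<Longrightarrow> l < 14 \<Longrightarrow> k dvd (\<Sum>j<14. G l j * G i j) + (if i = l then 1 else 0)"
    and x: "\<And>j. j < 14 \<Longrightarrow> k dvd x (14 + j) - (\<Sum>i<14. x i * G i j)"
  shows "x \<in> code_lattice k G"
proof -
  have "k dvd x i + (\<Sum>j<14. x (14 + j) * G i j)" if i: "i < 14" for i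
  proof -
    have "x i = (\<Sum>l<14. x l * (if i = l then 1 else 0))"
      using i by (simp add: if_distrib cong: if_cong)
    moreover have "(\<Sum>j<14. x (14 + j) * G i j) = (\<Sum>j<14. (x (14 + j) - (\<Sum>l<14. x l * G l j)) * G i j) +
        (\<Sum>j<14. \<Sum>l<14. x l * G l j * G i j)"
      by (simp add: left_diff_distrib sum_subtractf sum_distrib_right)
    moreover have "(\<Sum>j<14. \<Sum>l<14. x l * G l j * G i j) = (\<Sum>l<14. x l * (\<Sum>j<14. G l j * G i j))"
      by (subst sum.swap) (simp add: sum_distrib_left mult_ac)
    ultimately have "x i + (\<Sum>j<14. x (14 + j) * G i j) = (\<Sum>j<14. (x (14 + j) - (\<Sum>l<14. x l * G l j)) * G i j) +
        (\<Sum>l<14. x l * ((\<Sum>j<14. G l j * G i j) + (if i = l then 1 else 0)))"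
      by (simp add: distrib_left sum.distrib)
    moreover have "k dvd (\<Sum>j<14. (x (14 + j) - (\<Sum>l<14. x l * G l j)) * G i j)"
      using x by (intro dvd_sum dvd_mult2) simp
    moreover have "k dvd (\<Sum>l<14. x l * ((\<Sum>j<14. G l j * G i j) + (if i = l then 1 else 0)))"
      using G[OF i] by (intro dvd_sum dvd_mult) simp
    ultimately show ?thesis by simp
  qed
  then show ?thesis using x unfolding code_lattice_def by blast
qed

text \<open>The matrix of left multiplication by the quaternion \<open>a + b i + c j + d k\<close>, applied below to
  consecutive quadruples of frame vectors.\<close>

definition quat :: "int \<Rightarrow> int \<Rightarrow> int \<Rightarrow> int \<Rightarrow> nat \<Rightarrow> nat \<Rightarrow> int" where
  "quat a b c d r s = [[a, b, c, d], [- b, a, - d, c], [- c, d, a, - b], [- d, - c, b, a]] ! r ! s"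

lemma sum_quat:
  assumes "r < 4" "r' < 4"
  shows "(\<Sum>s<4. quat a b c d r s * quat a b c d r' s) = (if r = r' then a\<^sup>2 + b\<^sup>2 + c\<^sup>2 + d\<^sup>2 else 0)"
proof -
  have "r = 0 \<or> r = 1 \<or> r = 2 \<or> r = 3" "r' = 0 \<or> r' = 1 \<or> r' = 2 \<or> r' = 3" using assms by linarith+
  then show ?thesis
    by (elim disjE) (simp_all add: quat_def eval_nat_numeral power2_eq_square algebra_simps)
qed

lemma mixed_radix_eq: "s < 4 \<Longrightarrow> s' < 4 \<Longrightarrow> 4 * q + s = 4 * q' + s' \<longleftrightarrow> q = q' \<and> s = (s' :: nat)"
  by presburger

lemma zframe_mult_four_sq:
  assumes f: "zframe m (code_lattice k G) f" and n: "four_sq n"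
  shows "\<exists>f'. zframe (m * n) (code_lattice k G) f'"
proof -
  obtain a b c d where n: "n = a\<^sup>2 + b\<^sup>2 + c\<^sup>2 + d\<^sup>2" using n unfolding four_sq_def by blast
  define Q where "Q = quat a b c d"
  define f' where "f' i = (\<lambda>t. \<Sum>s<4. Q (i mod 4) s * f (4 * (i div 4) + s) t)" for i
  have lt: "4 * (i div 4) + s < 28" if "i < 28" "s < 4" for i s :: nat using that by presburger
  have "f' i \<in> code_lattice k G" if "i < 28" for i
    unfolding f'_def using f lt[OF that] by (intro code_lattice_sum) (simp add: zframe_def)
  moreover have "ip (f' i) (f' j) = (if i = j then m * n else 0)" if ij: "i < 28" "j < 28" for i j
  proof -
    have eq: "4 * (i div 4) + s = 4 * (j div 4) + s' \<longleftrightarrow> i div 4 = j div 4 \<and> s = s'" if "s < 4" "s' < 4" for s s'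
      using that by (rule mixed_radix_eq)
    have "ip (f' i) (f' j) = (\<Sum>s<4. Q (i mod 4) s * (\<Sum>s'<4. Q (j mod 4) s' *
        ip (f (4 * (i div 4) + s)) (f (4 * (j div 4) + s'))))"
      unfolding f'_def ip_sum_left ip_sum_right ..
    also have "\<dots> = (\<Sum>s<4. Q (i mod 4) s * (\<Sum>s'<4. Q (j mod 4) s' *
        (if i div 4 = j div 4 \<and> s = s' then m else 0)))"
      using f lt ij by (intro sum.cong refl arg_cong2[of _ _ _ _ "(*)"]) (auto simp: zframe_def eq)
    also have "\<dots> = (if i div 4 = j div 4 then m * (\<Sum>s<4. Q (i mod 4) s * Q (j mod 4) s) else 0)"
      by (cases "i div 4 = j div 4") (simp_all add: sum_distrib_left if_distrib mult_ac cong: if_cong)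
    also have "\<dots> = (if i div 4 = j div 4 \<and> i mod 4 = j mod 4 then m * n else 0)"
      unfolding Q_def by (simp add: sum_quat n)
    also have "i div 4 = j div 4 \<and> i mod 4 = j mod 4 \<longleftrightarrow> i = j" by (metis div_mult_mod_eq)
    finally show ?thesis .
  qed
  ultimately show ?thesis unfolding zframe_def by blast
qed

lemma three_le_cases:
  fixes n :: nat
  assumes "3 \<le> n"
  obtains p m where "prime p" "odd p" "n = p * m" | m where "n = 4 * m"
proof (cases "4 dvd n")
  case False
  define q where "q = (if odd n then n else n div 2)"
  have q: "odd q" "q dvd n" "q \<noteq> 1"
  proof -
    show "odd q" using False unfolding q_def by presburger
    show "q \<noteq> 1" using assms unfolding q_def by presburger
    show "q dvd n" unfolding q_def by (cases "odd n") (auto elim!: evenE)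
  qed
  obtain p where p: "prime p" "p dvd q" using q(3) prime_factor_nat by blast
  then have "odd p" using q(1) by (meson dvd_trans)
  moreover obtain m where "n = p * m" using p(2) q(2) by (meson dvd_trans dvdE)
  ultimately show ?thesis using p(1) that(1) by blast
qed (use that(2) in blast)

text \<open>The rows of \<open>U\<close> give an isometry from \<open>A\<^sub>3\<close> of the code \<open>(I  K)\<close> to \<open>A\<^sub>k\<close> of the code \<open>(I  G)\<close>.
  In the ternary coordinates, the rows of \<open>T\<close> are a 4-frame and the rows of \<open>V\<close> are the images
  of the 28 basis vectors of \<open>\<int>[i]\<^sup>1\<^sup>4\<close> under \<open>x \<mapsto> (1 + i) x + conj x B\<close>, real parts in front of
  imaginary parts; the equations \<open>V_sym\<close> say that \<open>B\<close> is skew-symmetric.\<close>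

locale frame_certificate =
  fixes k :: nat and K G V T U :: "nat \<Rightarrow> nat \<Rightarrow> int"
  assumes k_pos: "0 < k"
    and V_mem: "i < 28 \<Longrightarrow> V i \<in> code_lattice 3 K"
    and V_ip: "i < 28 \<Longrightarrow> j < 28 \<Longrightarrow> ip (V i) (V j) = (if i = j then 15 else 0)"
    and V_sym: "i < 14 \<Longrightarrow> j < 14 \<Longrightarrow> V i j + V j i = (if i = j then 2 else 0)"
      "i < 14 \<Longrightarrow> j < 14 \<Longrightarrow> V i (14 + j) + V j (14 + i) = (if i = j then 2 else 0)"
      "i < 14 \<Longrightarrow> j < 14 \<Longrightarrow> V (14 + i) j = - V j (14 + i)"
      "i < 14 \<Longrightarrow> j < 14 \<Longrightarrow> V (14 + i) (14 + j) = V j i"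
    and T_frame: "zframe 12 (code_lattice 3 K) T"
    and U_frame: "zframe (3 * int k) (code_lattice k G) U"
    and U_cols: "s < 28 \<Longrightarrow> t < 28 \<Longrightarrow> (\<Sum>a<28. U a s * U a t) = (if s = t then 3 * int k else 0)"
    and gen_row: "i < 14 \<Longrightarrow> \<exists>h\<in>code_lattice k G. \<forall>t<28. 3 * h t = U i t + (\<Sum>j<14. K i j * U (14 + j) t)"
    and gen_col: "j < 14 \<Longrightarrow> \<exists>h\<in>code_lattice k G. \<forall>t<28. 3 * h t = U (14 + j) t - (\<Sum>i<14. K i j * U i t)"
    and min_norm: "y \<in> code_lattice 3 K \<Longrightarrow> ip y y \<le> 6 \<Longrightarrow> ip y y = 0"
begin

text \<open>The vectors 3 e_a, which carry the summand 3 (g + h i) of alpha.\<close>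

definition E :: "nat \<Rightarrow> nat \<Rightarrow> int" where
  "E a t = (if a = t then 3 else 0)"

lemma E_mem: "E a \<in> code_lattice 3 K"
proof -
  have "3 dvd E a t" for t by (simp add: E_def)
  then show ?thesis unfolding code_lattice_def by (auto intro!: dvd_add dvd_diff dvd_sum dvd_mult2)
qed

lemma ip_E: "a < 28 \<Longrightarrow> ip (E a) x = 3 * x a"
  by (simp add: ip_def E_def if_distrib cong: if_cong) (simp add: if_distribR cong: if_cong)

lemma frame_form_zframe: "\<exists>f. zframe (3 * frame_form g h c d) (code_lattice 3 K) f"
proof -
  \<comment> \<open>Let M be the map x |-> (1 + i) x + conj(x) B and beta = c + d i. Since alpha =
    (1 + i) conj(beta) + 3 (g + h i), the vector alpha x + beta conj(x) B equals M(conj(beta) x) + 3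
    (g + h i) x. The two branches are its values at a basis vector of Z[i]^14 and at sqrt(-1) times
    a basis vector.\<close>
  define f where "f i = (if i < 14
      then (\<lambda>t. (c * V i t + (- d) * V (14 + i) t) + (g * E i t + h * E (14 + i) t))
      else (\<lambda>t. (c * V i t + d * V (i - 14) t) + (g * E i t + (- h) * E (i - 14) t)))" for i
  have mem: "f i \<in> code_lattice 3 K" if "i < 28" for i
  proof (cases "i < 14")
    case True
    show ?thesis unfolding f_def if_P[OF True]
      by (intro code_lattice_add code_lattice_scale V_mem E_mem) (use True in simp_all)
  next
    case False
    show ?thesis unfolding f_def if_not_P[OF False]
      by (intro code_lattice_add code_lattice_scale V_mem E_mem) (use that in simp_all)
  qed
  have f1: "f i = (\<lambda>t. (c * V i t + (- d) * V (14 + i) t) + (g * E i t + h * E (14 + i) t))" if "i < 14" for i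
    using that by (simp add: f_def)
  have f2: "f (14 + i) = (\<lambda>t. (c * V (14 + i) t + d * V i t) + (g * E (14 + i) t + (- h) * E i t))" for i
    by (simp add: f_def)
  have VE: "ip (V i) (E j) = 3 * V i j" if "j < 28" for i j using that ip_E[of j "V i"] by (simp add: ip_commute)
  have EE: "ip (E i) (E j) = (if i = j then 9 else 0)" if "i < 28" for i j
    using that by (simp add: ip_E E_def)
  have EV: "ip (E i) (V j) = 3 * V j i" if "i < 28" for i j
    using that by (simp add: ip_E)
  note ips = V_ip VE EE EV
  have 11: "ip (f i) (f j) = (if i = j then 3 * frame_form g h c d else 0)" if ij: "i < 14" "j < 14" for i j
  proof -
    have "ip (f i) (f j) = (if i = j then 15 * (c\<^sup>2 + d\<^sup>2) + 9 * (g\<^sup>2 + h\<^sup>2) else 0) +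
        3 * c * g * (V i j + V j i) + 3 * c * h * (V i (14 + j) + V j (14 + i))
        - 3 * d * g * (V (14 + i) j + V (14 + j) i) - 3 * d * h * (V (14 + i) (14 + j) + V (14 + j) (14 + i))"
      unfolding f1[OF ij(1)] f1[OF ij(2)] ip_linear using ij by (simp add: ips power2_eq_square algebra_simps)
    also have "V (14 + i) j + V (14 + j) i = - (if i = j then 2 else 0)"
      using ij V_sym(2)[of j i] by (auto simp: V_sym(3) split: if_splits)
    also have "V (14 + i) (14 + j) + V (14 + j) (14 + i) = (if i = j then 2 else 0)"
      using ij V_sym(1)[of j i] by (simp add: V_sym(4))
    finally show ?thesis unfolding V_sym(1,2)[OF ij]
      by (cases "i = j") (simp_all add: frame_form_def algebra_simps)
  qed
  have 12: "ip (f i) (f (14 + j)) = 0" if ij: "i < 14" "j < 14" for i j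
  proof -
    have "ip (f i) (f (14 + j)) =
        3 * c * g * (V i (14 + j) + V (14 + j) i) + 3 * c * h * (V (14 + j) (14 + i) - V i j)
        + 3 * d * g * (V j i - V (14 + i) (14 + j)) + 3 * d * h * (V (14 + i) j + V j (14 + i))"
      unfolding f1[OF ij(1)] f2 ip_linear using ij by (simp add: ips power2_eq_square algebra_simps)
    then show ?thesis
      unfolding V_sym(3,4)[OF ij] V_sym(3,4)[OF ij(2,1)] by simp
  qed
  have 22: "ip (f (14 + i)) (f (14 + j)) = (if i = j then 3 * frame_form g h c d else 0)" if ij: "i < 14" "j < 14" for i j
  proof -
    have "ip (f (14 + i)) (f (14 + j)) = (if i = j then 15 * (c\<^sup>2 + d\<^sup>2) + 9 * (g\<^sup>2 + h\<^sup>2) else 0) +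
        3 * c * g * (V (14 + i) (14 + j) + V (14 + j) (14 + i)) - 3 * c * h * (V (14 + i) j + V (14 + j) i)
        + 3 * d * g * (V i (14 + j) + V j (14 + i)) - 3 * d * h * (V i j + V j i)"
      unfolding f2 ip_linear using ij by (simp add: ips power2_eq_square algebra_simps)
    also have "V (14 + i) j + V (14 + j) i = - (if i = j then 2 else 0)"
      using ij V_sym(2)[of j i] by (auto simp: V_sym(3) split: if_splits)
    also have "V (14 + i) (14 + j) + V (14 + j) (14 + i) = (if i = j then 2 else 0)"
      using ij V_sym(1)[of j i] by (simp add: V_sym(4))
    finally show ?thesis unfolding V_sym(1,2)[OF ij]
      by (cases "i = j") (simp_all add: frame_form_def algebra_simps)
  qed
  have "ip (f i) (f j) = (if i = j then 3 * frame_form g h c d else 0)" if "i < 28" "j < 28" for i j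
  proof -
    have split: "a < 14 \<or> (\<exists>b<14. a = 14 + b)" if "a < 28" for a :: nat
      using that by presburger
    show ?thesis
    proof (cases "i < 14")
      case i: True
      show ?thesis
      proof (cases "j < 14")
        case True
        then show ?thesis using i 11 by blast
      next
        case False
        then obtain j' where j': "j' < 14" "j = 14 + j'" using split[OF \<open>j < 28\<close>] by blast
        then show ?thesis using 12[OF i j'(1)] i by simp
      qed
    next
      case False
      then obtain i' where i': "i' < 14" "i = 14 + i'" using split[OF \<open>i < 28\<close>] by blast
      show ?thesis
      proof (cases "j < 14")
        case True
        have "ip (f i) (f j) = 0" unfolding i'(2) by (subst ip_commute) (rule 12[OF True i'(1)])
        then show ?thesis using False True by auto
      next
        case False
        then obtain j' where j': "j' < 14" "j = 14 + j'" using split[OF \<open>j < 28\<close>] by blast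
        then show ?thesis using 22[OF i'(1) j'(1)] i' by simp
      qed
    qed
  qed
  then show ?thesis using mem unfolding zframe_def by blast
qed

text \<open>The map y |-> y U / 3 multiplies norms by k/3. The ternary lattice is spanned by the
  rows of (I K), which \<open>gen_row\<close> sends into the target, and by the vectors 3 e_(14 +
  j), which go to rows of \<open>U\<close>.\<close>

lemma transfer_frame:
  fixes n :: int
  assumes "zframe (3 * n) (code_lattice 3 K) f"
  shows "\<exists>f'. zframe (int k * n) (code_lattice k G) f'"
proof -
  have ex: "\<exists>x\<in>code_lattice k G. \<forall>t<28. 3 * x t = (\<Sum>a<28. y a * U a t)" if y: "y \<in> code_lattice 3 K" for y
  proof -
    have "\<forall>j. \<exists>z. j < 14 \<longrightarrow> y (14 + j) - (\<Sum>i<14. y i * K i j) = 3 * z"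
      using y unfolding code_lattice_def dvd_def by blast
    then obtain z where z: "\<And>j. j < 14 \<Longrightarrow> y (14 + j) - (\<Sum>i<14. y i * K i j) = 3 * z j"
      using choice[where Q = "\<lambda>j z. j < 14 \<longrightarrow> y (14 + j) - (\<Sum>i<14. y i * K i j) = 3 * z"] by blast
    have "\<forall>i. \<exists>h. i < 14 \<longrightarrow> h \<in> code_lattice k G \<and> (\<forall>t<28. 3 * h t = U i t + (\<Sum>j<14. K i j * U (14 + j) t))"
      using gen_row by blast
    from choice[OF this] obtain h where h: "\<And>i. i < 14 \<Longrightarrow> h i \<in> code_lattice k G"
      "\<And>i t. i < 14 \<Longrightarrow> t < 28 \<Longrightarrow> 3 * h i t = U i t + (\<Sum>j<14. K i j * U (14 + j) t)"
      by blast
    define x where "x = (\<lambda>t. (\<Sum>i<14. y i * h i t) + (\<Sum>j<14. z j * U (14 + j) t))"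
    have "x \<in> code_lattice k G" unfolding x_def
      using h(1) U_frame by (intro code_lattice_add code_lattice_sum[of "{..<14}"]) (auto simp: zframe_def)
    moreover have "3 * x t = (\<Sum>a<28. y a * U a t)" if t: "t < 28" for t
    proof -
      define B where "B = (\<Sum>i<14. \<Sum>j<14. y i * K i j * U (14 + j) t)"
      have "3 * x t = (\<Sum>i<14. y i * (3 * h i t)) + (\<Sum>j<14. (3 * z j) * U (14 + j) t)"
        by (simp add: x_def distrib_left sum_distrib_left mult_ac)
      also have "(\<Sum>i<14. y i * (3 * h i t)) = (\<Sum>i<14. y i * U i t) + B"
        using t unfolding B_def by (simp add: h(2) distrib_left sum.distrib sum_distrib_left mult.assoc)
      also have "(\<Sum>j<14. (3 * z j) * U (14 + j) t) =
          (\<Sum>j<14. (y (14 + j) - (\<Sum>i<14. y i * K i j)) * U (14 + j) t)"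
        by (simp add: z)
      also have "\<dots> = (\<Sum>j<14. y (14 + j) * U (14 + j) t) - (\<Sum>j<14. \<Sum>i<14. y i * K i j * U (14 + j) t)"
        by (simp add: left_diff_distrib sum_subtractf sum_distrib_right)
      also have "(\<Sum>j<14. \<Sum>i<14. y i * K i j * U (14 + j) t) = B"
        unfolding B_def by (rule sum.swap)
      finally show ?thesis unfolding sum_28 by simp
    qed
    ultimately show ?thesis by blast
  qed
  have "\<forall>i. \<exists>x. i < 28 \<longrightarrow> x \<in> code_lattice k G \<and> (\<forall>t<28. 3 * x t = (\<Sum>a<28. f i a * U a t))"
  proof
    fix i
    have "i < 28 \<Longrightarrow> f i \<in> code_lattice 3 K" using assms by (simp add: zframe_def)
    then show "\<exists>x. i < 28 \<longrightarrow> x \<in> code_lattice k G \<and> (\<forall>t<28. 3 * x t = (\<Sum>a<28. f i a * U a t))"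
      using ex[of "f i"] by blast
  qed
  from choice[OF this] obtain f' where f': "\<And>i. i < 28 \<Longrightarrow> f' i \<in> code_lattice k G"
    "\<And>i t. i < 28 \<Longrightarrow> t < 28 \<Longrightarrow> 3 * f' i t = (\<Sum>a<28. f i a * U a t)"
    by blast
  have "ip (f' i) (f' j) = (if i = j then int k * n else 0)" if ij: "i < 28" "j < 28" for i j
  proof -
    have "9 * ip (f' i) (f' j) = ip (\<lambda>t. 3 * f' i t) (\<lambda>t. 3 * f' j t)" by (simp add: ip_linear)
    also have "\<dots> = ip (\<lambda>t. \<Sum>a<28. f i a * U a t) (\<lambda>t. \<Sum>a<28. f j a * U a t)"
      using ij f'(2) by (intro ip_cong) simp_all
    also have "\<dots> = (\<Sum>a<28. f i a * (\<Sum>b<28. f j b * (if a = b then 3 * int k else 0)))"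
      unfolding ip_sum_left ip_sum_right using U_frame
      by (intro sum.cong refl arg_cong2[of _ _ _ _ "(*)"]) (simp add: zframe_def)
    also have "\<dots> = (\<Sum>a<28. f i a * (f j a * (3 * int k)))"
      by (intro sum.cong refl) (simp add: if_distrib cong: if_cong)
    also have "\<dots> = 3 * int k * ip (f i) (f j)"
      by (simp add: ip_def sum_distrib_left mult_ac)
    also have "\<dots> = 9 * (if i = j then int k * n else 0)" using assms ij by (simp add: zframe_def)
    finally show ?thesis by simp
  qed
  then have "zframe (int k * n) (code_lattice k G) f'" using f'(1) by (simp add: zframe_def)
  then show ?thesis by blast
qed

text \<open>The inverse map x |-> x U^T / k. Integrality and both ternary conditions hold because k
  divides the inner products of x with the rows of \<open>U\<close> and with the vectors from
  \<open>gen_col\<close> and \<open>gen_row\<close>; the norm follows from U^T U = 3 k I.\<close>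

lemma ternary_vector:
  assumes x: "x \<in> code_lattice k G"
  obtains y where "y \<in> code_lattice 3 K" "int k * ip y y = 3 * ip x x"
proof -
  define y where "y a = ip x (U a) div int k" for a
  have y: "ip x (U a) = int k * y a" if "a < 28" for a
    using dvd_ip_code_lattice[OF x, of "U a"] U_frame that unfolding zframe_def y_def by simp
  have "3 dvd y (14 + j) - (\<Sum>i<14. y i * K i j)" if j: "j < 14" for j
  proof -
    obtain h where h: "h \<in> code_lattice k G" "\<And>t. t < 28 \<Longrightarrow> 3 * h t = U (14 + j) t - (\<Sum>i<14. K i j * U i t)"
      using gen_col[OF j] by blast
    obtain w where w: "ip x h = int k * w" using dvd_ip_code_lattice[OF x h(1)] by blast
    have "3 * ip x h = ip x (\<lambda>t. 3 * h t)" by (simp add: ip_linear)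
    also have "\<dots> = ip x (\<lambda>t. U (14 + j) t + (\<Sum>i<14. (- K i j) * U i t))"
      using h(2) by (intro ip_cong) (auto simp: sum_negf)
    also have "\<dots> = int k * (y (14 + j) - (\<Sum>i<14. y i * K i j))"
      unfolding ip_add_right ip_sum_right using j
      by (simp add: y sum_negf sum_distrib_left right_diff_distrib mult_ac)
    finally have "int k * (y (14 + j) - (\<Sum>i<14. y i * K i j)) = int k * (3 * w)" unfolding w by (simp only: mult.left_commute)
    then show ?thesis using k_pos by simp
  qed
  moreover have "3 dvd y i + (\<Sum>j<14. y (14 + j) * K i j)" if i: "i < 14" for i
  proof -
    obtain h where h: "h \<in> code_lattice k G" "\<And>t. t < 28 \<Longrightarrow> 3 * h t = U i t + (\<Sum>j<14. K i j * U (14 + j) t)"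
      using gen_row[OF i] by blast
    obtain w where w: "ip x h = int k * w" using dvd_ip_code_lattice[OF x h(1)] by blast
    have "3 * ip x h = ip x (\<lambda>t. 3 * h t)" by (simp add: ip_linear)
    also have "\<dots> = ip x (\<lambda>t. U i t + (\<Sum>j<14. K i j * U (14 + j) t))"
      using h(2) by (intro ip_cong) auto
    also have "\<dots> = int k * (y i + (\<Sum>j<14. y (14 + j) * K i j))"
      unfolding ip_add_right ip_sum_right using i
      by (simp add: y sum_distrib_left distrib_left mult_ac)
    finally have "int k * (y i + (\<Sum>j<14. y (14 + j) * K i j)) = int k * (3 * w)" unfolding w by (simp only: mult.left_commute)
    then show ?thesis using k_pos by simp
  qed
  ultimately have mem: "y \<in> code_lattice 3 K" by (simp add: code_lattice_def)
  have "int k * (int k * ip y y) = (\<Sum>a<28. ip x (U a) * ip x (U a))"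
    by (simp add: y ip_def[of y] sum_distrib_left mult_ac)
  also have "\<dots> = (\<Sum>a<28. \<Sum>s<28. \<Sum>t<28. x s * x t * (U a s * U a t))"
    unfolding ip_def sum_product by (intro sum.cong refl) (simp add: mult_ac)
  also have "\<dots> = (\<Sum>s<28. \<Sum>a<28. \<Sum>t<28. x s * x t * (U a s * U a t))"
    by (rule sum.swap)
  also have "\<dots> = (\<Sum>s<28. \<Sum>t<28. \<Sum>a<28. x s * x t * (U a s * U a t))"
    by (intro sum.cong refl sum.swap)
  also have "\<dots> = (\<Sum>s<28. \<Sum>t<28. x s * x t * (if s = t then 3 * int k else 0))"
    by (intro sum.cong refl) (simp add: U_cols flip: sum_distrib_left)
  also have "\<dots> = (\<Sum>s<28. x s * x s * (3 * int k))"
    by (intro sum.cong refl) (simp add: if_distrib cong: if_cong)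
  also have "\<dots> = int k * (3 * ip x x)"
    by (simp add: ip_def sum_distrib_left mult_ac)
  finally have "int k * ip y y = 3 * ip x x" using k_pos by simp
  then show ?thesis using mem that by blast
qed

end

context frame_certificate
begin

theorem ex_zframe_iff:
  assumes "0 < n"
  shows "(\<exists>f. zframe (int k * int n) (code_lattice k G) f) \<longleftrightarrow> 3 \<le> n"
proof
  assume "\<exists>f. zframe (int k * int n) (code_lattice k G) f"
  then obtain f where f: "zframe (int k * int n) (code_lattice k G) f" by blast
  then have "f 0 \<in> code_lattice k G" "ip (f 0) (f 0) = int k * int n" by (simp_all add: zframe_def)
  then obtain y where y: "y \<in> code_lattice 3 K" "int k * ip y y = 3 * (int k * int n)"
    using ternary_vector by metis
  then have "int k * ip y y = int k * (3 * int n)" by simp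
  then have "ip y y = 3 * int n" using k_pos by simp
  \<comment> \<open>A frame vector with n equal to 1 or 2 would give a ternary vector of norm 3 or
    6, against \<open>min_norm\<close>.\<close>
  then show "3 \<le> n" using min_norm[OF y(1)] assms by (cases "n \<le> 2") auto
next
  assume "3 \<le> n"
  then have "\<exists>f. zframe (3 * int n) (code_lattice 3 K) f"
  proof (cases rule: three_le_cases)
    case (1 p m)
    have "prime (int p)" "odd (int p)" using 1 by simp_all
    then obtain g h c d where "int p = frame_form g h c d" by (rule prime_frame_form)
    then obtain f where "zframe (3 * int p) (code_lattice 3 K) f" using frame_form_zframe by metis
    then show ?thesis
      using zframe_mult_four_sq[OF _ lagrange_four_squares[of m]] 1 by (metis mult.assoc of_nat_mult)
  next
    case (2 m)
    then have "3 * int n = 12 * int m" by simp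
    then show ?thesis using zframe_mult_four_sq[OF T_frame lagrange_four_squares[of m]] by metis
  qed
  then show "\<exists>f. zframe (int k * int n) (code_lattice k G) f" using transfer_frame by blast
qed

end

section \<open>Minimum weight of ternary codes\<close>

text \<open>The disjunct \<open>n = 0\<close> exempts the zero combination.\<close>

definition heavy :: "nat \<Rightarrow> int list \<Rightarrow> bool" where
  "heavy n acc \<longleftrightarrow> n = 0 \<or> 6 < n + length (filter (\<lambda>a. a mod 3 \<noteq> 0) acc)"

text \<open>A search over all combinations of at most \<open>w\<close> rows with coefficients \<open>\<plusminus>1\<close>: the number \<open>n\<close> of
  rows used and the weight of the combination \<open>acc\<close> must add up to more than 6.\<close>

fun light :: "int list list \<Rightarrow> nat \<Rightarrow> nat \<Rightarrow> int list \<Rightarrow> bool" where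
  "light [] w n acc = heavy n acc"
| "light (v # vs) 0 n acc = heavy n acc"
| "light (v # vs) (Suc w) n acc = (light vs (Suc w) n acc \<and>
     light vs w (Suc n) (map2 (+) acc v) \<and> light vs w (Suc n) (map2 (-) acc v))"

text \<open>Arbitrary \<open>n\<close> and \<open>acc\<close> let the induction absorb the first
  row: the three values of its coefficient correspond to the three branches of
  \<open>light\<close>.\<close>

lemma light_sound:
  assumes "light vs w n acc" "\<forall>v\<in>set vs. length v = length acc"
    "\<forall>i<length vs. r i \<in> {- 1, 0, 1}" "(\<Sum>i<length vs. \<bar>r i\<bar>) \<le> int w"
  shows "int n + (\<Sum>i<length vs. \<bar>r i\<bar>) = 0 \<or> 6 < int n + (\<Sum>i<length vs. \<bar>r i\<bar>) +
    int (card {j. j < length acc \<and> (acc ! j + (\<Sum>i<length vs. r i * vs ! i ! j)) mod 3 \<noteq> 0})"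
  using assms
proof (induction vs arbitrary: w n acc r)
  case Nil
  then show ?case by (auto simp: heavy_def length_filter_conv_card)
next
  case (Cons v vs)
  show ?case
  proof (cases w)
    case 0
    have "(\<Sum>i<length (v # vs). \<bar>r i\<bar>) = 0"
      using Cons.prems(4) 0 by (intro order.antisym sum_nonneg abs_ge_zero) (simp only: of_nat_0)
    then have "\<forall>i<length (v # vs). r i = 0" by (subst (asm) sum_nonneg_eq_0_iff) auto
    then have "(\<Sum>i<length (v # vs). \<bar>r i\<bar>) = 0" "(\<Sum>i<length (v # vs). r i * (v # vs) ! i ! j) = 0" for j
      by (auto intro!: sum.neutral)
    then show ?thesis using Cons.prems(1) 0 by (auto simp: heavy_def length_filter_conv_card)
  next
    case w: (Suc w0)
  define r' where "r' i = r (Suc i)" for i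
  have r': "\<forall>i<length vs. r' i \<in> {- 1, 0, 1}" using Cons.prems(3) by (auto simp: r'_def)
  have len: "length v = length acc" using Cons.prems(2) by simp
  have s: "(\<Sum>i<length (v # vs). \<bar>r i\<bar>) = \<bar>r 0\<bar> + (\<Sum>i<length vs. \<bar>r' i\<bar>)"
    unfolding list.size(4) by (simp add: r'_def sum.lessThan_Suc_shift del: sum.lessThan_Suc)
  have t: "(\<Sum>i<length (v # vs). r i * (v # vs) ! i ! j) = r 0 * v ! j + (\<Sum>i<length vs. r' i * vs ! i ! j)" for j
    unfolding list.size(4) by (simp add: r'_def sum.lessThan_Suc_shift del: sum.lessThan_Suc)
  have nn: "0 \<le> (\<Sum>i<length vs. \<bar>r' i\<bar>)" by (simp add: sum_nonneg)
  have step: ?thesis if acc': "length acc' = length acc" "\<And>j. j < length acc \<Longrightarrow> acc' ! j = acc ! j + r 0 * v ! j"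
    and l: "light vs w' n' acc'" and w': "(\<Sum>i<length vs. \<bar>r' i\<bar>) \<le> int w'" and n': "int n' = int n + \<bar>r 0\<bar>"
  for acc' w' n'
  proof -
    have "{j. j < length acc' \<and> (acc' ! j + (\<Sum>i<length vs. r' i * vs ! i ! j)) mod 3 \<noteq> 0} =
        {j. j < length acc \<and> (acc ! j + (\<Sum>i<length (v # vs). r i * (v # vs) ! i ! j)) mod 3 \<noteq> 0}"
      unfolding t using acc' by (auto simp: add.assoc)
    moreover have "\<forall>v\<in>set vs. length v = length acc'" using Cons.prems(2) acc'(1) by simp
    ultimately show ?thesis using Cons.IH[OF l _ r' w'] unfolding s n' by (simp add: add.assoc)
  qed
  have "r 0 \<in> {- 1, 0, 1}" using Cons.prems(3) by auto
  then consider "r 0 = 0" | "r 0 = 1" | "r 0 = - 1" by blast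
  then show ?thesis
  proof cases
    case 1
    show ?thesis by (rule step[of acc w n]) (use Cons.prems 1 s w in simp_all)
  next
    case 2
    have "(\<Sum>i<length vs. \<bar>r' i\<bar>) \<le> int w0" using Cons.prems(4) s 2 w by simp
    then show ?thesis
      by (intro step[of "map2 (+) acc v" w0 "Suc n"]) (use Cons.prems(1) w 2 len in simp_all)
  next
    case 3
    have "(\<Sum>i<length vs. \<bar>r' i\<bar>) \<le> int w0" using Cons.prems(4) s 3 w by simp
    then show ?thesis
      by (intro step[of "map2 (-) acc v" w0 "Suc n"]) (use Cons.prems(1) w 3 len in simp_all)
  qed
  qed
qed

lemma abs_le_1_of_square_le: "(x :: int)\<^sup>2 \<le> 3 \<Longrightarrow> x \<in> {- 1, 0, 1}"
proof -
  assume "x\<^sup>2 \<le> 3"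
  then have "\<bar>x\<bar>\<^sup>2 < 2\<^sup>2" by simp
  then have "\<bar>x\<bar> < 2" by (rule power2_less_imp_less) simp
  then show ?thesis by auto
qed

text \<open>Norm at most 3 on the half \<open>r\<close> leaves only coefficients 0, 1, -1, at most
  three of them nonzero, so the search covers them; every nonzero residue on the half
  \<open>s\<close> costs at least 1. Once \<open>r\<close> vanishes, the entries of \<open>s\<close>
  are multiples of 3 and a nonzero one would cost 9.\<close>

lemma light_half:
  assumes "light vs 3 0 (replicate 14 0)" "length vs = 14" "\<forall>v\<in>set vs. length v = 14"
    and s: "\<And>j. j < 14 \<Longrightarrow> 3 dvd s j - (\<Sum>i<14. r i * vs ! i ! j)"
    and "(\<Sum>i<14. (r i)\<^sup>2) \<le> 3" "(\<Sum>i<14. (r i)\<^sup>2) + (\<Sum>j<14. (s j)\<^sup>2) \<le> 6"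
  shows "(\<Sum>i<14. (r i)\<^sup>2) + (\<Sum>j<14. (s j)\<^sup>2) = 0"
proof -
  have mem: "r i \<in> {- 1, 0, 1}" if "i < 14" for i
  proof -
    have "(r i)\<^sup>2 \<le> (\<Sum>i<14. (r i)\<^sup>2)" using that by (intro member_le_sum) auto
    then show ?thesis using assms(5) by (intro abs_le_1_of_square_le) simp
  qed
  have "(\<Sum>i<14. (r i)\<^sup>2) = (\<Sum>i<14. \<bar>r i\<bar>)"
  proof (intro sum.cong refl)
    fix i :: nat assume "i \<in> {..<14}"
    then show "(r i)\<^sup>2 = \<bar>r i\<bar>" using mem[of i] by auto
  qed
  note sq = this
  define J where "J = {j. j < 14 \<and> (\<Sum>i<14. r i * vs ! i ! j) mod 3 \<noteq> 0}"
  have a: "\<forall>v\<in>set vs. length v = length (replicate 14 (0 :: int))" using assms(3) by simp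
  have b: "\<forall>i<length vs. r i \<in> {- 1, 0, 1}" using mem assms(2) by simp
  have c: "(\<Sum>i<length vs. \<bar>r i\<bar>) \<le> int 3" using assms(2,5) sq by simp
  have J: "J = {j. j < length (replicate 14 (0 :: int)) \<and> (replicate 14 0 ! j + (\<Sum>i<length vs. r i * vs ! i ! j)) mod 3 \<noteq> 0}"
    unfolding J_def assms(2) by (intro Collect_cong conj_cong) simp_all
  have dis: "(\<Sum>i<14. \<bar>r i\<bar>) = 0 \<or> 6 < (\<Sum>i<14. \<bar>r i\<bar>) + int (card J)"
    using light_sound[OF assms(1) a b c, folded J, unfolded assms(2)] by simp
  have "int (card J) = (\<Sum>j\<in>J. 1)" by simp
  also have "\<dots> \<le> (\<Sum>j\<in>J. (s j)\<^sup>2)"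
  proof (rule sum_mono)
    fix j assume j: "j \<in> J"
    then have "j < 14" "\<not> 3 dvd (\<Sum>i<14. r i * vs ! i ! j)" by (simp_all add: J_def dvd_eq_mod_eq_0)
    then have "s j \<noteq> 0" using s[of j] by fastforce
    then have "0 < (s j)\<^sup>2" by simp
    then show "1 \<le> (s j)\<^sup>2" by linarith
  qed
  also have "\<dots> \<le> (\<Sum>j<14. (s j)\<^sup>2)" by (rule sum_mono2) (auto simp: J_def)
  finally have "(\<Sum>i<14. \<bar>r i\<bar>) = 0" using dis assms(6) sq by linarith
  then have r0: "r i = 0" if "i < 14" for i using that by (simp add: sum_nonneg_eq_0_iff)
  have "s j = 0" if j: "j < 14" for j
  proof (rule ccontr)
    assume "s j \<noteq> 0"
    have "(\<Sum>i<14. r i * vs ! i ! j) = 0" using r0 by simp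
    then have "3 dvd s j" using s[OF j] by simp
    then obtain u where u: "s j = 3 * u" by (rule dvdE)
    then have "0 < u\<^sup>2" using \<open>s j \<noteq> 0\<close> by simp
    then have "1 \<le> u\<^sup>2" by linarith
    then have "(s j)\<^sup>2 \<ge> 9" by (simp add: u power_mult_distrib)
    moreover have "(s j)\<^sup>2 \<le> (\<Sum>j<14. (s j)\<^sup>2)" using j by (intro member_le_sum) auto
    moreover have "0 \<le> (\<Sum>i<14. (r i)\<^sup>2)" by (simp add: sum_nonneg)
    ultimately show False using assms(6) by linarith
  qed
  then show ?thesis using r0 by simp
qed

definition columns :: "int list list \<Rightarrow> int list list" where
  "columns K = map (\<lambda>j. map (\<lambda>v. v ! j) K) [0..<14]"

lemma min_norm_of_light:
  assumes K: "length K = 14" "\<forall>v\<in>set K. length v = 14" "light K 3 0 (replicate 14 0)"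
    and KT: "light (columns K) 3 0 (replicate 14 0)"
    and y: "y \<in> code_lattice 3 (\<lambda>i j. K ! i ! j)" "ip y y \<le> 6"
  shows "ip y y = 0"
proof -
  have T: "length (columns K) = 14" "\<forall>v\<in>set (columns K). length v = 14"
    "\<And>i j. i < 14 \<Longrightarrow> j < 14 \<Longrightarrow> columns K ! j ! i = K ! i ! j"
    using K by (auto simp: columns_def)
  have ip: "ip y y = (\<Sum>i<14. (y i)\<^sup>2) + (\<Sum>j<14. (y (14 + j))\<^sup>2)"
    unfolding ip_def sum_28 by (simp add: power2_eq_square)
  \<comment> \<open>A total of at most 6 leaves at most 3 on one of the two halves.\<close>
  consider "(\<Sum>i<14. (y i)\<^sup>2) \<le> 3" | "(\<Sum>j<14. (y (14 + j))\<^sup>2) \<le> 3" using y(2) ip by linarith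
  then show ?thesis
  proof cases
    case 1
    show ?thesis unfolding ip
      by (rule light_half[OF K(3,1,2)]) (use y 1 ip in \<open>auto simp: code_lattice_def\<close>)
  next
    case 2
    \<comment> \<open>The dual condition says that minus the first half is the second half times
      K^T, so the halves exchange roles and the columns of K become the rows of the search.\<close>
    have "(\<Sum>j<14. (y (14 + j))\<^sup>2) + (\<Sum>i<14. (- y i)\<^sup>2) = 0"
    proof (rule light_half[OF KT T(1,2)])
      fix i :: nat assume i: "i < 14"
      have eq: "- y i - (\<Sum>j<14. y (14 + j) * columns K ! j ! i) = - (y i + (\<Sum>j<14. y (14 + j) * K ! i ! j))"
        using i T(3) by simp
      then show "3 dvd - y i - (\<Sum>j<14. y (14 + j) * columns K ! j ! i)"
        unfolding eq dvd_minus_iff using y(1) i by (simp add: code_lattice_def)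
    qed (use 2 y(2) ip in auto)
    then show ?thesis unfolding ip by simp
  qed
qed

section \<open>Construction A\<close>

text \<open>As the generator matrix starts with an identity block, the first 14 coordinates of a
  code word are its coefficients modulo k.\<close>

lemma vec_mod_mem_code_iff:
  assumes B: "B \<in> carrier_mat 14 14" and x: "x \<in> carrier_vec 28"
  shows "vec_mod k x \<in> code_generated k (hconcat_mat (1\<^sub>m 14) B) \<longleftrightarrow>
    (\<forall>j<14. int k dvd x $ (14 + j) - (\<Sum>i<14. x $ i * B $$ (i, j)))"
proof -
  let ?G = "hconcat_mat (1\<^sub>m 14) B"
  have G: "?G \<in> carrier_mat 14 28" using B by (simp add: hconcat_mat_def)
  have prod: "(transpose_mat ?G *\<^sub>v c) $ t = (if t < 14 then c $ t else \<Sum>i<14. c $ i * B $$ (i, t - 14))"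
    if "c \<in> carrier_vec 14" "t < 28" for c t
  proof -
    have s: "(transpose_mat ?G *\<^sub>v c) $ t = (\<Sum>i<14. ?G $$ (i, t) * c $ i)"
      using that G by (simp add: scalar_prod_def atLeast0LessThan)
    show ?thesis
    proof (cases "t < 14")
      case True
      have "(\<Sum>i<14. ?G $$ (i, t) * c $ i) = (\<Sum>i<14. if i = t then c $ i else 0)"
        using True by (intro sum.cong refl) (simp add: hconcat_mat_def)
      then show ?thesis using s True by simp
    next
      case False
      have "(\<Sum>i<14. ?G $$ (i, t) * c $ i) = (\<Sum>i<14. c $ i * B $$ (i, t - 14))"
        using False that(2) B by (intro sum.cong refl) (simp add: hconcat_mat_def)
      then show ?thesis using s False by simp
    qed
  qed
  show ?thesis
  proof
    assume "vec_mod k x \<in> code_generated k ?G"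
    then obtain c where c: "vec_mod k x = vec_mod k (transpose_mat ?G *\<^sub>v c)" "c \<in> carrier_vec 14"
      using G by (auto simp: code_generated_def)
    have eq: "x $ t mod int k = (transpose_mat ?G *\<^sub>v c) $ t mod int k" if "t < 28" for t
    proof -
      have "vec_mod k x $ t = vec_mod k (transpose_mat ?G *\<^sub>v c) $ t" using c(1) by simp
      then show ?thesis using that x G by (simp add: vec_mod_def)
    qed
    show "\<forall>j<14. int k dvd x $ (14 + j) - (\<Sum>i<14. x $ i * B $$ (i, j))"
    proof (intro allI impI)
      fix j :: nat assume j: "j < 14"
      have "int k dvd x $ i - c $ i" if "i < 14" for i
        using eq[of i] prod[OF c(2), of i] that by (simp add: mod_eq_dvd_iff)
      then have 1: "int k dvd (\<Sum>i<14. (x $ i - c $ i) * B $$ (i, j))" by (intro dvd_sum dvd_mult2) simp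
      have 2: "int k dvd x $ (14 + j) - (\<Sum>i<14. c $ i * B $$ (i, j))"
        using eq[of "14 + j"] prod[OF c(2), of "14 + j"] j by (simp add: mod_eq_dvd_iff)
      show "int k dvd x $ (14 + j) - (\<Sum>i<14. x $ i * B $$ (i, j))"
        using dvd_diff[OF 2 1] by (simp add: left_diff_distrib sum_subtractf)
    qed
  next
    assume *: "\<forall>j<14. int k dvd x $ (14 + j) - (\<Sum>i<14. x $ i * B $$ (i, j))"
    define c where "c = vec 14 (\<lambda>i. x $ i)"
    have c: "c \<in> carrier_vec 14" by (simp add: c_def)
    have "vec_mod k x = vec_mod k (transpose_mat ?G *\<^sub>v c)"
    proof (rule eq_vecI)
      fix t assume "t < dim_vec (vec_mod k (transpose_mat ?G *\<^sub>v c))"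
      then have t: "t < 28" using G by (simp add: vec_mod_def)
      have "x $ t mod int k = (transpose_mat ?G *\<^sub>v c) $ t mod int k"
      proof (cases "t < 14")
        case True
        then show ?thesis using prod[OF c t] by (simp add: c_def)
      next
        case False
        then have "int k dvd x $ t - (\<Sum>i<14. x $ i * B $$ (i, t - 14))" using *[rule_format, of "t - 14"] t by simp
        then show ?thesis using prod[OF c t] False by (simp add: c_def mod_eq_dvd_iff)
      qed
      then show "vec_mod k x $ t = vec_mod k (transpose_mat ?G *\<^sub>v c) $ t"
        using t x G by (simp add: vec_mod_def)
    qed (use x G in \<open>simp add: vec_mod_def\<close>)
    then show "vec_mod k x \<in> code_generated k ?G" using c G by (auto simp: code_generated_def)
  qed
qed

text \<open>Removing the factor 1 / sqrt k multiplies inner products by k, so everything can be done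
  with integer vectors whose frame norm is k n.\<close>

lemma contains_frame_iff_zframe:
  assumes B: "B \<in> carrier_mat 14 14" and G: "\<And>i j. i < 14 \<Longrightarrow> j < 14 \<Longrightarrow> B $$ (i, j) = G i j"
    and "0 < k"
    and GG: "\<And>i l. i < 14 \<Longrightarrow> l < 14 \<Longrightarrow> int k dvd (\<Sum>j<14. G l j * G i j) + (if i = l then 1 else 0)"
  shows "contains_frame 28 n (construction_A 28 k (code_generated k (hconcat_mat (1\<^sub>m 14) B))) \<longleftrightarrow>
    (\<exists>f. zframe (int k * int n) (code_lattice k G) f)"
proof -
  have mem: "vec_mod k x \<in> code_generated k (hconcat_mat (1\<^sub>m 14) B) \<longleftrightarrow> (\<lambda>t. x $ t) \<in> code_lattice k G"
    if "x \<in> carrier_vec 28" for x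
  proof -
    have "(\<forall>j<14. int k dvd x $ (14 + j) - (\<Sum>i<14. x $ i * B $$ (i, j))) \<longleftrightarrow>
        (\<forall>j<14. int k dvd x $ (14 + j) - (\<Sum>i<14. x $ i * G i j))"
      by (simp add: G)
    moreover have "\<dots> \<longleftrightarrow> (\<lambda>t. x $ t) \<in> code_lattice k G"
    proof
      assume "\<forall>j<14. int k dvd x $ (14 + j) - (\<Sum>i<14. x $ i * G i j)"
      then show "(\<lambda>t. x $ t) \<in> code_lattice k G" by (intro code_lattice_of_first_half GG) simp_all
    qed (simp add: code_lattice_def)
    ultimately show ?thesis unfolding vec_mod_mem_code_iff[OF B that] by simp
  qed
  \<comment> \<open>Integer vectors are functions on all natural numbers here, and
    \<open>code_lattice\<close> reads only the values below 28.\<close>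
  have mem': "f \<in> code_lattice k G \<longleftrightarrow> (\<lambda>t. vec 28 f $ t) \<in> code_lattice k G" for f
    by (simp add: code_lattice_def)
  have sp: "scalar_prod ((1 / sqrt (real k)) \<cdot>\<^sub>v map_vec real_of_int x) ((1 / sqrt (real k)) \<cdot>\<^sub>v map_vec real_of_int y)
      = real_of_int (ip (\<lambda>t. x $ t) (\<lambda>t. y $ t)) / real k"
    if "x \<in> carrier_vec 28" "y \<in> carrier_vec 28" for x y
    using that \<open>0 < k\<close> by (simp add: scalar_prod_def ip_def atLeast0LessThan sum_divide_distrib)
  have div: "real_of_int a / real k = (if P then real n else 0) \<longleftrightarrow> a = (if P then int k * int n else 0)" for a P
  proof -
    have "real_of_int a / real k = real n \<longleftrightarrow> real_of_int a = real_of_int (int k * int n)"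
      using \<open>0 < k\<close> by (simp add: field_simps)
    then show ?thesis using \<open>0 < k\<close> by (simp only: of_int_eq_iff) simp
  qed
  show ?thesis
  proof
    assume "contains_frame 28 n (construction_A 28 k (code_generated k (hconcat_mat (1\<^sub>m 14) B)))"
    then obtain f where f: "is_frame 28 n (construction_A 28 k (code_generated k (hconcat_mat (1\<^sub>m 14) B))) f"
      by (auto simp: contains_frame_def)
    have "\<forall>i. \<exists>x. i < 28 \<longrightarrow> f i = (1 / sqrt (real k)) \<cdot>\<^sub>v map_vec real_of_int x \<and> x \<in> carrier_vec 28 \<and> (\<lambda>t. x $ t) \<in> code_lattice k G"
      using f mem unfolding is_frame_def construction_A_def by blast
    from choice[OF this] obtain x where x: "\<And>i. i < 28 \<Longrightarrow> f i = (1 / sqrt (real k)) \<cdot>\<^sub>v map_vec real_of_int (x i)"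
      "\<And>i. i < 28 \<Longrightarrow> x i \<in> carrier_vec 28" "\<And>i. i < 28 \<Longrightarrow> (\<lambda>t. x i $ t) \<in> code_lattice k G" by blast
    have "ip (\<lambda>t. x i $ t) (\<lambda>t. x j $ t) = (if i = j then int k * int n else 0)" if "i < 28" "j < 28" for i j
      using f that sp[OF x(2)[OF that(1)] x(2)[OF that(2)]] unfolding is_frame_def div[symmetric] by (simp add: x(1))
    then have "zframe (int k * int n) (code_lattice k G) (\<lambda>i t. x i $ t)" using x(3) by (simp add: zframe_def)
    then show "\<exists>f. zframe (int k * int n) (code_lattice k G) f" by blast
  next
    assume "\<exists>f. zframe (int k * int n) (code_lattice k G) f"
    then obtain f where f: "zframe (int k * int n) (code_lattice k G) f" by blast
    define x where "x i = vec 28 (f i)" for i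
    define F where "F i = (1 / sqrt (real k)) \<cdot>\<^sub>v map_vec real_of_int (x i)" for i
    have x: "x i \<in> carrier_vec 28" for i by (simp add: x_def)
    have "F i \<in> construction_A 28 k (code_generated k (hconcat_mat (1\<^sub>m 14) B))" if "i < 28" for i
    proof -
      have "(\<lambda>t. x i $ t) \<in> code_lattice k G" unfolding x_def mem'[symmetric] using f that by (simp add: zframe_def)
      then have "vec_mod k (x i) \<in> code_generated k (hconcat_mat (1\<^sub>m 14) B)" using mem[OF x] by simp
      then show ?thesis unfolding construction_A_def F_def using x by blast
    qed
    moreover have "scalar_prod (F i) (F j) = (if i = j then real n else 0)" if "i < 28" "j < 28" for i j
    proof -
      have "ip (\<lambda>t. x i $ t) (\<lambda>t. x j $ t) = ip (f i) (f j)" by (intro ip_cong) (simp_all add: x_def)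
      also have "\<dots> = (if i = j then int k * int n else 0)" using f that by (simp add: zframe_def)
      finally show ?thesis unfolding F_def sp[OF x x] div .
    qed
    ultimately have "is_frame 28 n (construction_A 28 k (code_generated k (hconcat_mat (1\<^sub>m 14) B))) F"
      by (simp add: is_frame_def)
    then show "contains_frame 28 n (construction_A 28 k (code_generated k (hconcat_mat (1\<^sub>m 14) B)))"
      unfolding contains_frame_def by blast
  qed
qed

section \<open>Certificates\<close>

definition negashift :: "int list \<Rightarrow> int list" where
  "negashift r = - last r # butlast r"

text \<open>All matrices below consist of negacirculant blocks of size 7, and only the first row of each
  row of blocks is given.\<close>

definition expand :: "int list list list \<Rightarrow> int list list" where
  "expand bs = concat (map (\<lambda>b. map (\<lambda>s. concat (map (negashift ^^ s) b)) [0..<7]) bs)"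

definition dot :: "int list \<Rightarrow> int list \<Rightarrow> int" where
  "dot x y = sum_list (map2 (*) x y)"

definition shape :: "nat \<Rightarrow> nat \<Rightarrow> int list list \<Rightarrow> bool" where
  "shape n m X \<longleftrightarrow> length X = n \<and> list_all (\<lambda>x. length x = m) X"

fun gram :: "int \<Rightarrow> int list list \<Rightarrow> bool" where
  "gram m [] = True"
| "gram m (x # xs) = (dot x x = m \<and> list_all (\<lambda>y. dot x y = 0) xs \<and> gram m xs)"

definition in_code :: "int \<Rightarrow> int list list \<Rightarrow> int list list \<Rightarrow> int list \<Rightarrow> bool" where
  "in_code k G GT x \<longleftrightarrow>
     list_all (\<lambda>(a, g). (a - dot (take 14 x) g) mod k = 0) (zip (drop 14 x) GT) \<and>
     list_all (\<lambda>(a, g). (a + dot (drop 14 x) g) mod k = 0) (zip (take 14 x) G)"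

definition columns28 :: "int list list \<Rightarrow> int list list" where
  "columns28 X = map (\<lambda>t. map (\<lambda>x. x ! t) X) [0..<28]"

definition third_in_code :: "int \<Rightarrow> int list list \<Rightarrow> int list list \<Rightarrow> int list \<Rightarrow> bool" where
  "third_in_code k G GT x \<longleftrightarrow> list_all (\<lambda>a. a mod 3 = 0) x \<and> in_code k G GT (map (\<lambda>a. a div 3) x)"

text \<open>The operation \<open>op\<close> is addition for the rows of (I K) and subtraction for
  the rows of (-K^T I); \<open>cs\<close> lists the columns of the half of \<open>U\<close> that is
  multiplied by the matrix.\<close>

definition gen_check ::
    "(int \<Rightarrow> int \<Rightarrow> int) \<Rightarrow> int \<Rightarrow> int list list \<Rightarrow> int list list \<Rightarrow> int list list \<Rightarrow> int list list \<Rightarrow> int list list \<Rightarrow> bool" where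
  "gen_check op k G GT us ks cs \<longleftrightarrow>
     list_all (\<lambda>(u, v). third_in_code k G GT (map2 (\<lambda>a c. op a (dot v c)) u cs)) (zip us ks)"

definition skew_check :: "int list list \<Rightarrow> bool" where
  "skew_check V \<longleftrightarrow> list_all (\<lambda>i. list_all (\<lambda>j. V ! i ! j + V ! j ! i = (if i = j then 2 else 0) \<and>
      V ! i ! (14 + j) + V ! j ! (14 + i) = (if i = j then 2 else 0) \<and>
      V ! (14 + i) ! j = - (V ! j ! (14 + i)) \<and> V ! (14 + i) ! (14 + j) = V ! j ! i) [0..<14]) [0..<14]"

definition self_dual_check :: "int \<Rightarrow> int list list \<Rightarrow> bool" where
  "self_dual_check k G \<longleftrightarrow>
     list_all (\<lambda>i. list_all (\<lambda>l. (dot (G ! l) (G ! i) + (if i = l then 1 else 0)) mod k = 0) [0..<14]) [0..<14]"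

definition entry :: "int list list \<Rightarrow> nat \<Rightarrow> nat \<Rightarrow> int" where
  "entry X i j = X ! i ! j"

section \<open>Soundness of the executable checks\<close>

lemma shapeD: "shape n m X \<Longrightarrow> length X = n" "shape n m X \<Longrightarrow> i < n \<Longrightarrow> length (X ! i) = m"
  "shape n m X \<Longrightarrow> \<forall>x\<in>set X. length x = m"
  by (auto simp: shape_def list_all_iff)

lemma dot_eq_sum: "length x = n \<Longrightarrow> length y = n \<Longrightarrow> dot x y = (\<Sum>t<n. x ! t * y ! t)"
  by (simp add: dot_def sum_list_sum_nth atLeast0LessThan)

lemma dot_commute: "dot x y = dot y x"
proof (induction x arbitrary: y)
  case (Cons a x)
  then show ?case by (cases y) (simp_all add: dot_def mult.commute)
qed (simp add: dot_def)

lemma dot_gram: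
  "gram m xs \<Longrightarrow> i < length xs \<Longrightarrow> j < length xs \<Longrightarrow> dot (xs ! i) (xs ! j) = (if i = j then m else 0)"
proof (induction xs arbitrary: i j)
  case (Cons x xs)
  have 0: "dot x (xs ! l) = 0" if "l < length xs" for l using Cons.prems(1) that by (simp add: list_all_iff)
  show ?case
  proof (cases i)
    case i: 0
    then show ?thesis using Cons.prems 0 by (cases j) simp_all
  next
    case (Suc i')
    show ?thesis
    proof (cases j)
      case 0
      have "dot (xs ! i') x = 0" using Suc Cons.prems(2) \<open>\<And>l. l < length xs \<Longrightarrow> dot x (xs ! l) = 0\<close>[of i']
        by (subst dot_commute) simp
      then show ?thesis using Suc 0 by simp
    next
      case (Suc j')
      then show ?thesis using Cons \<open>i = Suc i'\<close> by simp
    qed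
  qed
qed simp

lemma entry_mem_code_lattice:
  assumes "length x = 28" "shape 14 14 G" "in_code k G (columns G) x"
  shows "(\<lambda>t. x ! t) \<in> code_lattice k (entry G)"
proof -
  have len: "length (take 14 x) = 14" "length (drop 14 x) = 14" using assms(1) by simp_all
  note G = shapeD[OF assms(2)]
  have col: "length (columns G) = 14" "\<And>i j. i < 14 \<Longrightarrow> j < 14 \<Longrightarrow> columns G ! j ! i = G ! i ! j"
    "\<And>j. j < 14 \<Longrightarrow> length (columns G ! j) = 14"
    using G(1) by (simp_all add: columns_def)
  have 1: "k dvd x ! (14 + j) - (\<Sum>i<14. x ! i * entry G i j)" if j: "j < 14" for j
  proof -
    have "(drop 14 x ! j, columns G ! j) \<in> set (zip (drop 14 x) (columns G))"
      using nth_mem[of j "zip (drop 14 x) (columns G)"] len col(1) j by simp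
    then have "(drop 14 x ! j - dot (take 14 x) (columns G ! j)) mod k = 0"
      using assms(3) unfolding in_code_def list_all_iff by fast
    moreover have "dot (take 14 x) (columns G ! j) = (\<Sum>i<14. x ! i * entry G i j)"
      using j col(2,3) len by (subst dot_eq_sum[of _ 14]) (auto simp: entry_def)
    ultimately show ?thesis using assms(1) by (simp add: dvd_eq_mod_eq_0)
  qed
  have 2: "k dvd x ! i + (\<Sum>j<14. x ! (14 + j) * entry G i j)" if i: "i < 14" for i
  proof -
    have "(take 14 x ! i, G ! i) \<in> set (zip (take 14 x) G)"
      using nth_mem[of i "zip (take 14 x) G"] len G(1) i by simp
    then have "(take 14 x ! i + dot (drop 14 x) (G ! i)) mod k = 0"
      using assms(3) unfolding in_code_def list_all_iff by fast
    moreover have "dot (drop 14 x) (G ! i) = (\<Sum>j<14. x ! (14 + j) * entry G i j)"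
      using i G(2) len assms(1) by (subst dot_eq_sum[of _ 14]) (auto simp: entry_def)
    ultimately show ?thesis using i by (simp add: dvd_eq_mod_eq_0)
  qed
  show ?thesis using 1 2 by (simp add: code_lattice_def)
qed

lemma ip_entry: "shape 28 28 X \<Longrightarrow> i < 28 \<Longrightarrow> j < 28 \<Longrightarrow> ip (entry X i) (entry X j) = dot (X ! i) (X ! j)"
  by (simp add: ip_def entry_def[abs_def] dot_eq_sum[of _ 28] shapeD)

lemma zframe_entry:
  assumes "shape 28 28 X" "shape 14 14 G" "list_all (in_code k G (columns G)) X" "gram m X"
  shows "zframe m (code_lattice k (entry G)) (entry X)"
  unfolding zframe_def
proof (intro conjI allI impI)
  fix i :: nat assume i: "i < 28"
  have "in_code k G (columns G) (X ! i)" using assms(3) shapeD(1)[OF assms(1)] i by (simp add: list_all_length)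
  then show "entry X i \<in> code_lattice k (entry G)"
    using entry_mem_code_lattice[OF shapeD(2)[OF assms(1) i] assms(2)] by (simp add: entry_def[abs_def])
next
  fix i j :: nat assume "i < 28" "j < 28"
  then show "ip (entry X i) (entry X j) = (if i = j then m else 0)"
    using dot_gram[OF assms(4)] shapeD(1)[OF assms(1)] by (simp add: ip_entry[OF assms(1)])
qed

lemma third_in_codeD:
  assumes "length x = 28" "shape 14 14 G" "third_in_code k G (columns G) x"
  shows "\<exists>h\<in>code_lattice k (entry G). \<forall>t<28. 3 * h t = x ! t"
proof (intro bexI allI impI)
  fix t :: nat assume "t < 28"
  then have "3 dvd x ! t" using assms(1,3) by (simp add: third_in_code_def list_all_length dvd_eq_mod_eq_0)
  then show "3 * map (\<lambda>a. a div 3) x ! t = x ! t" using \<open>t < 28\<close> assms(1) by simp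
next
  show "(\<lambda>t. map (\<lambda>a. a div 3) x ! t) \<in> code_lattice k (entry G)"
    by (rule entry_mem_code_lattice) (use assms in \<open>simp_all add: third_in_code_def\<close>)
qed

lemma gen_checkD:
  assumes g: "gen_check op k G (columns G) us K (columns28 X)" and G: "shape 14 14 G"
    and us: "shape 14 28 us" and X: "shape 14 28 X" and K: "shape 14 14 K" and i: "i < 14"
  shows "\<exists>h\<in>code_lattice k (entry G). \<forall>t<28. 3 * h t = op (us ! i ! t) (\<Sum>j<14. K ! i ! j * X ! j ! t)"
proof -
  let ?x = "map2 (\<lambda>a c. op a (dot (K ! i) c)) (us ! i) (columns28 X)"
  have "(us ! i, K ! i) \<in> set (zip us K)"
    using nth_mem[of i "zip us K"] shapeD(1)[OF us] shapeD(1)[OF K] i by simp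
  then have "third_in_code k G (columns G) ?x" using g unfolding gen_check_def list_all_iff by fast
  moreover have len: "length ?x = 28" using shapeD[OF us] i by (simp add: columns28_def)
  moreover have "?x ! t = op (us ! i ! t) (\<Sum>j<14. K ! i ! j * X ! j ! t)" if "t < 28" for t
    using that i shapeD[OF us] shapeD[OF K] shapeD[OF X] by (simp add: columns28_def dot_eq_sum[of _ 14])
  ultimately show ?thesis using third_in_codeD[OF len G] by simp
qed

lemma frame_certificateI:
  assumes "0 < k" and K: "shape 14 14 K" and G: "shape 14 14 G" and V: "shape 28 28 V" and T: "shape 28 28 T"
    and U: "shape 28 28 U"
    and V_code: "list_all (in_code 3 K (columns K)) V" and V_gram: "gram 15 V" and V_skew: "skew_check V"
    and T_code: "list_all (in_code 3 K (columns K)) T" and T_gram: "gram 12 T"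
    and U_code: "list_all (in_code (int k) G (columns G)) U" and U_gram: "gram (3 * int k) U"
    and U_cols: "gram (3 * int k) (columns28 U)"
    and gen_row: "gen_check (+) (int k) G (columns G) (take 14 U) K (columns28 (drop 14 U))"
    and gen_col: "gen_check (-) (int k) G (columns G) (drop 14 U) (columns K) (columns28 (take 14 U))"
    and light: "light K 3 0 (replicate 14 0)" "light (columns K) 3 0 (replicate 14 0)"
  shows "frame_certificate k (entry K) (entry G) (entry V) (entry T) (entry U)"
proof (rule frame_certificate.intro)
  note VF = zframe_entry[OF V K V_code V_gram]
  show "0 < k" by fact
  show "entry V i \<in> code_lattice 3 (entry K)" if "i < 28" for i using VF that by (simp add: zframe_def)
  show "ip (entry V i) (entry V j) = (if i = j then 15 else 0)" if "i < 28" "j < 28" for i j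
    using VF that by (simp add: zframe_def)
  show "entry V i j + entry V j i = (if i = j then 2 else 0)"
    "entry V i (14 + j) + entry V j (14 + i) = (if i = j then 2 else 0)"
    "entry V (14 + i) j = - entry V j (14 + i)" "entry V (14 + i) (14 + j) = entry V j i"
    if "i < 14" "j < 14" for i j
    using V_skew that unfolding skew_check_def list_all_iff by (simp_all add: entry_def)
  show "zframe 12 (code_lattice 3 (entry K)) (entry T)" by (rule zframe_entry) fact+
  show "zframe (3 * int k) (code_lattice (int k) (entry G)) (entry U)" by (rule zframe_entry) fact+
  show "(\<Sum>a<28. entry U a s * entry U a t) = (if s = t then 3 * int k else 0)" if "s < 28" "t < 28" for s t
    using dot_gram[OF U_cols, of s t] that shapeD(1)[OF U] by (simp add: columns28_def dot_eq_sum[of _ 28] entry_def)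
  show "\<exists>h\<in>code_lattice (int k) (entry G). \<forall>t<28. 3 * h t = entry U i t + (\<Sum>j<14. entry K i j * entry U (14 + j) t)"
    if i: "i < 14" for i
  proof -
    have "shape 14 28 (take 14 U)" "shape 14 28 (drop 14 U)"
      using U by (auto simp: shape_def list_all_iff dest: in_set_takeD in_set_dropD)
    from gen_checkD[OF gen_row G this K i] show ?thesis
      using i shapeD(1)[OF U] by (simp add: entry_def)
  qed
  show "\<exists>h\<in>code_lattice (int k) (entry G). \<forall>t<28. 3 * h t = entry U (14 + j) t - (\<Sum>i<14. entry K i j * entry U i t)"
    if j: "j < 14" for j
  proof -
    have "shape 14 28 (take 14 U)" "shape 14 28 (drop 14 U)"
      using U by (auto simp: shape_def list_all_iff dest: in_set_takeD in_set_dropD)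
    moreover have "shape 14 14 (columns K)" using shapeD(1)[OF K] by (simp add: shape_def columns_def list_all_iff)
    ultimately show ?thesis using gen_checkD[OF gen_col G] j shapeD(1)[OF U] shapeD(1)[OF K]
      by (simp add: entry_def columns_def)
  qed
  show "ip y y = 0" if "y \<in> code_lattice 3 (entry K)" "ip y y \<le> 6" for y
    by (rule min_norm_of_light[of K]) (use that shapeD[OF K] light in \<open>simp_all add: entry_def[abs_def]\<close>)
qed

lemma self_dual_checkD:
  assumes "self_dual_check k G" "shape 14 14 G" "i < 14" "l < 14"
  shows "k dvd (\<Sum>j<14. entry G l j * entry G i j) + (if i = l then 1 else 0)"
  using assms shapeD(2)[OF assms(2)]
  by (simp add: self_dual_check_def list_all_iff dvd_eq_mod_eq_0 entry_def dot_eq_sum[of _ 14])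

section \<open>Entries of the given generator matrices\<close>

definition negacirculant_entry :: "int list \<Rightarrow> nat \<Rightarrow> nat \<Rightarrow> int" where
  "negacirculant_entry r i j = (if i \<le> j then r ! (j - i) else - (r ! (7 + j - i)))"

text \<open>A computable form of the entries, so that evaluation can compare \<open>G1\<close> and
  \<open>G2\<close> with the given matrices.\<close>

definition N_entry :: "int list \<Rightarrow> int list \<Rightarrow> nat \<Rightarrow> nat \<Rightarrow> int" where
  "N_entry a b i j = (if i < 7
     then if j < 7 then negacirculant_entry a i j else negacirculant_entry b i (j - 7)
     else if j < 7 then - negacirculant_entry b j (i - 7) else negacirculant_entry a (j - 7) (i - 7))"

lemma N_mat_index:
  assumes "length a = 7" "length b = 7" "i < 14" "j < 14"
  shows "N_mat (negacirculant a) (negacirculant b) $$ (i, j) = N_entry a b i j"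
  using assms by (simp add: N_mat_def negacirculant_def N_entry_def negacirculant_entry_def)

text \<open>The matrices were found by a computer search for skew-symmetric \<open>B\<close> with negacirculant blocks and
  for frames invariant under the blockwise negacyclic shift.\<close>

definition K1 :: "int list list" where
  "K1 = expand
   [[[1, 1, 0, -1, 0, 0, 0], [1, -1, -1, 1, 0, 1, 0]],
    [[-1, 0, 1, 0, 1, -1, -1], [1, 0, 0, 0, 1, 0, -1]]]"

text \<open>This is \<open>D14\<close> plus the identity. The transpose of a negacirculant matrix
  with first row (r_0, r_1, ..., r_6) is negacirculant with first row (r_0, -r_6, ..., -r_1), so the
  lower blocks can be expanded as well. In the same way \<open>G2\<close> is \<open>D14'\<close>
  plus twice the identity.\<close>

definition G1 :: "int list list" where
  "G1 = expand
   [[[1, 2, 1, 0, 0, 1, 2], [-1, -2, 1, -2, 2, 1, 0]],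
    [[1, 0, 1, 2, -2, 1, -2], [1, -2, -1, 0, 0, -1, -2]]]"

definition V1 :: "int list list" where
  "V1 = expand
   [[[1, 0, 1, -1, -1, 1, 0], [1, 0, 1, -1, 0, 0, 0], [1, -1, 0, 0, 0, 0, -1], [1, 0, 1, 0, 0, -1, -1]],
    [[-1, 0, 0, 0, -1, 1, 0], [1, 0, -1, 1, 1, -1, 0], [-1, -1, -1, 0, 0, 1, 0], [1, 1, 0, 0, 0, 0, 1]],
    [[-1, -1, 0, 0, 0, 0, -1], [1, 0, 1, 0, 0, -1, -1], [1, 0, -1, 1, 1, -1, 0], [-1, 0, -1, 1, 0, 0, 0]],
    [[-1, -1, -1, 0, 0, 1, 0], [-1, 1, 0, 0, 0, 0, 1], [1, 0, 0, 0, 1, -1, 0], [1, 0, 1, -1, -1, 1, 0]]]"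

definition T1 :: "int list list" where
  "T1 = expand
   [[[0, 0, 0, 0, 0, 0, 1], [0, 0, 0, 1, 0, -1, 1], [-1, 0, 0, 0, 0, 0, 0], [0, 1, 1, 0, -2, 0, -1]],
    [[0, 0, 0, 1, -1, 0, 1], [0, 0, 0, -1, 0, 0, 0], [-1, -1, 0, -1, 0, -2, 0], [0, 0, -1, 0, 0, 0, 0]],
    [[0, 0, 0, 0, 0, -1, 0], [0, 0, 0, 1, -2, -1, -1], [0, 0, 0, 0, 0, 0, 1], [1, 0, -1, 1, 0, 0, 0]],
    [[-1, -1, -2, 1, 0, 0, 0], [0, 1, 0, 0, 0, 0, 0], [0, 0, 0, 1, -1, 0, 1], [-1, 0, 0, 0, 0, 0, 0]]]"

definition U1 :: "int list list" where
  "U1 = expand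
   [[[0, 0, 0, 0, 0, 0, 1], [0, 0, 0, 1, 0, 1, 0], [-1, -1, 1, 0, 1, 0, 0], [0, 0, 1, 0, -1, 0, 0]],
    [[1, 0, 0, 0, 0, -1, 0], [0, 0, 0, 0, 1, 0, 0], [0, 1, 0, 0, 0, 0, 1], [0, -1, 1, 1, 0, 0, 1]],
    [[0, 0, 1, 0, 0, 1, 0], [0, 0, 1, 1, 0, -1, 1], [0, 0, 0, -1, 0, -1, 0], [0, 0, 0, 1, 0, 0, 0]],
    [[1, 1, 0, 0, -1, 1, 0], [0, -1, 0, 0, 0, 1, 0], [1, 0, 0, 0, 0, 0, 0], [1, 0, 0, 0, 0, -1, 0]]]"

definition K2 :: "int list list" where
  "K2 = expand
   [[[-1, 0, -1, 0, 0, 0, 1], [-1, 0, 1, -1, -1, 0, -1]],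
    [[0, -1, 1, 0, -1, 1, 1], [0, -1, -1, 0, -1, 0, 0]]]"

definition G2 :: "int list list" where
  "G2 = expand
   [[[2, 0, 2, -1, -1, 2, 0], [-2, -1, -2, 0, -1, -1, -2]],
    [[2, -2, -1, -1, 0, -2, -1], [2, 0, -2, 1, 1, -2, 0]]]"

definition V2 :: "int list list" where
  "V2 = expand
   [[[1, -1, 0, -1, -1, 0, -1], [1, 0, 0, 0, 0, -1, 0], [1, -1, 0, 1, 1, 0, -1], [1, 0, 0, 0, 0, -1, 1]],
    [[-1, 0, -1, 0, 0, 0, 0], [1, -1, 0, 1, 1, 0, -1], [-1, 1, -1, 0, 0, 0, 0], [1, 1, 0, 1, 1, 0, 1]],
    [[-1, -1, 0, 1, 1, 0, -1], [1, 0, 0, 0, 0, -1, 1], [1, 1, 0, 1, 1, 0, 1], [-1, 0, 0, 0, 0, 1, 0]],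
    [[-1, 1, -1, 0, 0, 0, 0], [-1, 1, 0, 1, 1, 0, 1], [1, 0, 1, 0, 0, 0, 0], [1, 1, 0, -1, -1, 0, 1]]]"

definition T2 :: "int list list" where
  "T2 = expand
   [[[0, 0, 0, 0, 0, 0, 0], [0, 0, 1, -1, 1, 0, -1], [0, -1, 0, 0, 0, -1, 0], [-2, 0, 0, 1, 0, 0, 1]],
    [[0, 0, 1, -1, 1, 0, -1], [0, 0, 0, 0, 0, 0, 0], [0, 1, 0, 0, -2, -1, 0], [0, 0, 0, 1, 0, 0, -1]],
    [[0, 0, -1, 0, 0, 1, 0], [0, 2, 1, 0, 0, 1, 0], [0, 0, 0, 0, 0, 0, 0], [0, 0, 1, 0, -1, 1, -1]],
    [[-1, 0, 0, -1, -2, 0, 0], [1, 0, 0, -1, 0, 0, 0], [0, 0, 1, 0, -1, 1, -1], [0, 0, 0, 0, 0, 0, 0]]]"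

definition U2 :: "int list list" where
  "U2 = expand
   [[[0, 0, 0, 1, 0, -1, 1], [1, 0, 0, 1, 0, -1, 0], [-1, -1, 0, -1, 0, 0, 1], [-1, 1, 0, -1, -1, 1, 0]],
    [[-1, -1, 0, 0, 0, -1, 2], [0, 1, 0, 0, -1, 0, 0], [0, 0, 0, 1, 0, -1, 1], [1, 0, 0, 1, 0, -1, 0]],
    [[0, 0, 0, -1, 0, 0, 1], [-1, -2, 1, 0, 0, 0, 1], [-1, 0, -1, 0, 1, 0, 0], [0, -1, 1, 0, -1, 0, 0]],
    [[-1, 0, 1, 0, 0, 1, 0], [1, 0, -1, 0, 0, 0, 1], [1, -1, -1, 0, 1, -1, 0], [0, 0, 1, 0, 1, 1, 1]]]"

section \<open>Evaluation of the certificates\<close>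

lemma shape1: "shape 14 14 K1" "shape 14 14 G1" "shape 28 28 V1" "shape 28 28 T1" "shape 28 28 U1"
  by code_simp+

text \<open>The constants are 15 = |1 + i|^2 + 13 for the similarity and 12 = 3 * 4 for a 4-frame
  before division by sqrt 3.\<close>

lemma frame_checks1:
  "list_all (in_code 3 K1 (columns K1)) V1" "gram 15 V1" "skew_check V1"
  "list_all (in_code 3 K1 (columns K1)) T1" "gram 12 T1"
  by code_simp+

text \<open>The constant 9 is 3 k for k = 3. Orthogonality of the rows of \<open>U1\<close> carries
  frames over to the given lattice; orthogonality of its columns pulls short vectors back.\<close>

lemma isometry_checks1:
  "list_all (in_code 3 G1 (columns G1)) U1" "gram 9 U1" "gram 9 (columns28 U1)"
  "gen_check (+) 3 G1 (columns G1) (take 14 U1) K1 (columns28 (drop 14 U1))"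
  "gen_check (-) 3 G1 (columns G1) (drop 14 U1) (columns K1) (columns28 (take 14 U1))"
  by code_simp+

lemma light_check1: "light K1 3 0 (replicate 14 0)" "light (columns K1) 3 0 (replicate 14 0)"
  by code_simp+

lemma shape2: "shape 14 14 K2" "shape 14 14 G2" "shape 28 28 V2" "shape 28 28 T2" "shape 28 28 U2"
  by code_simp+

lemma frame_checks2:
  "list_all (in_code 3 K2 (columns K2)) V2" "gram 15 V2" "skew_check V2"
  "list_all (in_code 3 K2 (columns K2)) T2" "gram 12 T2"
  by code_simp+

lemma isometry_checks2:
  "list_all (in_code 5 G2 (columns G2)) U2" "gram 15 U2" "gram 15 (columns28 U2)"
  "gen_check (+) 5 G2 (columns G2) (take 14 U2) K2 (columns28 (drop 14 U2))"
  "gen_check (-) 5 G2 (columns G2) (drop 14 U2) (columns K2) (columns28 (take 14 U2))"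
  by code_simp+

lemma light_check2: "light K2 3 0 (replicate 14 0)" "light (columns K2) 3 0 (replicate 14 0)"
  by code_simp+

lemma certificate1: "frame_certificate 3 (entry K1) (entry G1) (entry V1) (entry T1) (entry U1)"
  by (rule frame_certificateI[OF _ shape1]) (simp_all add: frame_checks1 isometry_checks1 light_check1)

lemma certificate2: "frame_certificate 5 (entry K2) (entry G2) (entry V2) (entry T2) (entry U2)"
  by (rule frame_certificateI[OF _ shape2]) (simp_all add: frame_checks2 isometry_checks2 light_check2)

lemma self_dual_checks: "self_dual_check 3 G1" "self_dual_check 5 G2"
  by code_simp+

lemma D14_index:
  assumes "i < 14" "j < 14"
  shows "(D14 + 1\<^sub>m 14) $$ (i, j) = entry G1 i j"
proof -
  have c: "list_all (\<lambda>i. list_all (\<lambda>j. N_entry [0, 2, 1, 0, 0, 1, 2] [-1, -2, 1, -2, 2, 1, 0] i j + (if i = j then 1 else 0)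
      = entry G1 i j) [0..<14]) [0..<14]"
    by code_simp
  have "D14 $$ (i, j) = N_entry [0, 2, 1, 0, 0, 1, 2] [-1, -2, 1, -2, 2, 1, 0] i j"
    unfolding D14_def by (rule N_mat_index) (use assms in simp_all)
  moreover have "i \<in> {0..<14}" "j \<in> {0..<14}" using assms by simp_all
  note c[unfolded list_all_iff set_upt, rule_format, OF this]
  ultimately show ?thesis using assms by (cases "i = j") simp_all
qed

lemma D14'_index:
  assumes "i < 14" "j < 14"
  shows "(D14' + 2 \<cdot>\<^sub>m 1\<^sub>m 14) $$ (i, j) = entry G2 i j"
proof -
  have c: "list_all (\<lambda>i. list_all (\<lambda>j. N_entry [0, 0, 2, -1, -1, 2, 0] [-2, -1, -2, 0, -1, -1, -2] i j + (if i = j then 2 else 0)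
      = entry G2 i j) [0..<14]) [0..<14]"
    by code_simp
  have "D14' $$ (i, j) = N_entry [0, 0, 2, -1, -1, 2, 0] [-2, -1, -2, 0, -1, -1, -2] i j"
    unfolding D14'_def by (rule N_mat_index) (use assms in simp_all)
  moreover have "i \<in> {0..<14}" "j \<in> {0..<14}" using assms by simp_all
  note c[unfolded list_all_iff set_upt, rule_format, OF this]
  ultimately show ?thesis using assms by (cases "i = j") simp_all
qed

theorem theorem4p8:
  fixes L :: "real vec set" and k :: nat
  assumes "L = construction_A 28 3 (C_28_3 D14) \<or> L = construction_A 28 5 (C_28_5 D14')"
    and "k > 0"
  shows "contains_frame 28 k L \<longleftrightarrow> k \<ge> 3"
  using assms(1)
proof
  assume L: "L = construction_A 28 3 (C_28_3 D14)"
  have "D14 + 1\<^sub>m 14 \<in> carrier_mat 14 14" unfolding D14_def by (intro add_carrier_mat) simp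
  then have "contains_frame 28 k L \<longleftrightarrow> (\<exists>f. zframe (int 3 * int k) (code_lattice (int 3) (entry G1)) f)"
    unfolding L C_28_3_def
    by (rule contains_frame_iff_zframe) (use D14_index self_dual_checkD[OF self_dual_checks(1) shape1(2)] in simp_all)
  then show ?thesis using frame_certificate.ex_zframe_iff[OF certificate1 assms(2)] by simp
next
  assume L: "L = construction_A 28 5 (C_28_5 D14')"
  have "D14' + 2 \<cdot>\<^sub>m 1\<^sub>m 14 \<in> carrier_mat 14 14" unfolding D14'_def by (intro add_carrier_mat) simp
  then have "contains_frame 28 k L \<longleftrightarrow> (\<exists>f. zframe (int 5 * int k) (code_lattice (int 5) (entry G2)) f)"
    unfolding L C_28_5_def
    by (rule contains_frame_iff_zframe) (use D14'_index self_dual_checkD[OF self_dual_checks(2) shape2(2)] in simp_all)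
  then show ?thesis using frame_certificate.ex_zframe_iff[OF certificate2 assms(2)] by simp
qed

end
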